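(* Let $f_h$ be the semi-discrete solution of the DG formulation (DG) given in the context (with weight $e^{H}$, upwind fluxes, and periodic boundary conditions in all directions) for the Boltzmann–Poisson system in the momentum coordinates $(p,\mu)$, and let $\Omega$ be the whole computational domain in $(x,p,\mu)$. Then $$0\;\ge\;\int_{\Omega}f_h\,\partial_t f_h\,e^{H(x,p,t)}\,p^2\,dp\,d\mu\,dx\;=\;\frac12\int_{\Omega}\partial_t\big(f_h^2\big)\,e^{H(x,p,t)}\,p^2\,dp\,d\mu\,dx .$$
   Context: Variables and mesh. $x\in[0,L]$, $p\in[0,p_{max}]$, $\mu\in[-1,1]$, $t\geq 0$; $\Omega=[0,L]\times[0,p_{max}]\times[-1,1]$ is the union of the cells $\Omega_{ikm}=[x_{i-},x_{i+}]\times[p_{k-},p_{k+}]\times[\mu_{m-},\mu_{m+}]$. $\int_{ikm}$ denotes integration over $\Omega_{ikm}$; $\int_{km},\int_{im},\int_{ik}$ denote integration over $[p_{k-},p_{k+}]\times[\mu_{m-},\mu_{m+}]$, $[x_{i-},x_{i+}]\times[\mu_{m-},\mu_{m+}]$, $[x_{i-},x_{i+}]\times[p_{k-},p_{k+}]$ respectively. $V_h^k$ is the space of functions that are polynomials of degree at most $k$ in $(x,p,\mu)$ on each cell. At a face, superscripts $-$ and $+$ denote the one-sided limits from the side of smaller, respectively larger, values of the coordinate. Data. $\varepsilon(p)$ is a smooth energy band with $\partial_p\varepsilon>0$, with inverse $p(\varepsilon)$ and $\varepsilon_{max}=\varepsilon(p_{max})$; $q>0$ is the electric charge; $V(x,t)$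 is the electric potential, solving the Poisson equation $-\partial_x^2V=\frac{q}{\epsilon}\big[N(x)-2\pi\int_{-1}^{1}\int_0^{p_{max}}f_h\,p^2\,dp\,d\mu\big]$ with constant permittivity $\epsilon$ and doping $N(x)$ (in the diode problem the boundary data are $V(0)=0$, $V(L)=V_0$); $E=-\partial_xV$. Energies are measured in units of $K_BT$, and $$H(x,p,t)=\varepsilon(p)-qV(x,t).$$ For the present result periodic boundary conditions are assumed in all directions, i.e. opposite boundary faces are identified and treated like interior faces. Collision operator. For azimuthally symmetric $f$, $$Q(f)(x,p,\mu,t)=2\pi\sum_{j=-1}^{1}c_j\int_{-1}^{1}d\mu'\Big[f(x,p(\varepsilon'),\mu',t)\,p^2(\varepsilon')\tfrac{dp}{d\varepsilon'}\chi(\varepsilon')\Big]_{\varepsilon'=\varepsilon(p)+j\hbar\omega}-4\pi f(x,p,\mu,t)\sum_{j=-1}^{1}c_j\Big[p^2(\varepsilon')\tfrac{dp}{d\varepsilon'}\chi(\varepsilon')\Big]_{\varepsilon'=\varepsilon(p)-j\hbar\omega},$$ where $\chi(\varepsilon)=1$ for $\varepsilon\in[0,\varepsilon_{max}]$ and $0$ otherwise, $\hbar\omega>0$ is the constant phonon energy, $c_1=(n_{ph}+1)K$, $c_{-1}=n_{ph}K$, and $K,c_0\ge0$ are constants, $n_{ph}$ being the phonon density. Equivalently, $Q(f)=\int S(\vec p\,'\to\vec p)f'\,d\vec p\,'-f\int S(\vec p\to\vec p\,')\,d\vec p\,'$ over $\Omega_{\vec p}=\{|\vec p|\le p_{max}\}$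 with kernel $S(\vec p\,'\to\vec p)=\sum_{j=-1}^{1}c_j\,\delta(\varepsilon(\vec p\,')-\varepsilon(\vec p)-j\hbar\omega)\geq 0$ and $\vec p=p(\mu,\sqrt{1-\mu^2}\cos\varphi,\sqrt{1-\mu^2}\sin\varphi)$. The collision operator has the dissipative property (a standing property of the model): for all $f,g$, $$\int_{\Omega_{\vec p}}Q(f)\,g\,d\vec p=-\frac12\int_{\Omega_{\vec p}}\int_{\Omega_{\vec p}}S(\vec p\,'\to\vec p)\,e^{-\varepsilon(p')}\Big(\frac{f'}{e^{-\varepsilon(p')}}-\frac{f}{e^{-\varepsilon(p)}}\Big)(g'-g)\,d\vec p\,'\,d\vec p ,$$ where primes denote evaluation at $\vec p\,'$. Formulation (DG). Find $f_h(\cdot,t)\in V_h^k$ such that for all $g_h\in V_h^k$ and all cells $\Omega_{ikm}$, $$\int_{ikm}\partial_tf_h\,g_h\,e^H p^2\,dp\,d\mu\,dx$$ $$-\int_{ikm}\partial_p\varepsilon\,f_h\,\mu\,\partial_x(g_he^H)\,p^2\,dp\,d\mu\,dx\;\pm\int_{km}\partial_p\varepsilon\,\widehat{f_h\mu}|_{x_{i\pm}}\,g_he^H|^{\mp}_{x_{i\pm}}\,p^2\,dp\,d\mu$$ $$-\int_{ikm}p^2(-qE)f_h\,\mu\,\partial_p(g_he^H)\,dp\,d\mu\,dx\;\pm\int_{im}p_{k\pm}^2\,(-q\widehat{Ef_h\mu})|_{p_{k\pm}}\,g_he^H|^{\mp}_{p_{k\pm}}\,d\mu\,dx$$ $$-\int_{ikm}(1-\mu^2)f_h(-qE)\,\partial_\mu(g_he^H)\,p\,dp\,d\mu\,dx\;\pm\int_{ik}(1-\mu_{m\pm}^2)(-q\widehat{Ef_h})|_{\mu_{m\pm}}\,g_he^H|^{\mp}_{\mu_{m\pm}}\,p\,dp\,dx$$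 $$=\int_{ikm}Q(f_h)\,g_h\,e^H p^2\,dp\,d\mu\,dx ,$$ where "$\pm\int$" means the term at the upper face (with $+$) minus the term at the lower face, and the fluxes are the upwind ones: $$\widehat{f_h\mu}|_{x_{i\pm}}=\tfrac{\mu+|\mu|}{2}f_h|^-_{x_{i\pm}}+\tfrac{\mu-|\mu|}{2}f_h|^+_{x_{i\pm}},$$ $$-\widehat{qE\mu f_h}|_{p_{k\pm}}=\tfrac{-qE\mu+|qE\mu|}{2}f_h|^-_{p_{k\pm}}+\tfrac{-qE\mu-|qE\mu|}{2}f_h|^+_{p_{k\pm}},$$ $$-\widehat{qEf_h}|_{\mu_{m\pm}}=\tfrac{-qE+|qE|}{2}f_h|^-_{\mu_{m\pm}}+\tfrac{-qE-|qE|}{2}f_h|^+_{\mu_{m\pm}}.$$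
   Formalization: At the identified faces p=0 and p=p_max the upwind flux wraps p·f_h instead of f_h, so nothing flows in at p_max; with f_h itself wrapped the inequality can fail (K=c_0=0, f_h decreasing in p). Periodicity in x includes V(0,t)=V(L,t), and ε(0)=0. *)

theory Defs
  imports "HOL-Analysis.Analysis"
begin

text \<open>
  Integrals are Henstock--Kurzweil integrals, hence insensitive to the values of a piecewise
  polynomial on the mesh faces (a null set), which are left arbitrary.
\<close>

record bp_data =
  len :: real                        \<comment> \<open>\<open>L\<close>\<close>
  pmax :: real
  nx :: nat                          \<comment> \<open>numbers of cells in the directions \<open>x, p, \<mu>\<close>\<close>
  np :: nat
  nm :: nat
  xs :: "nat \<Rightarrow> real"                 \<comment> \<open>nodes: the cell \<open>i\<close> in \<open>x\<close> is \<open>[xs i, xs (i + 1)]\<close>\<close>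
  ps :: "nat \<Rightarrow> real"
  ms :: "nat \<Rightarrow> real"
  band :: "real \<Rightarrow> real"              \<comment> \<open>\<open>\<epsilon>(p)\<close>, energies in units of \<open>K\<^sub>B T\<close>\<close>
  charge :: real                     \<comment> \<open>\<open>q\<close>\<close>
  permittivity :: real
  doping :: "real \<Rightarrow> real"            \<comment> \<open>\<open>N(x)\<close>\<close>
  phonon_energy :: real              \<comment> \<open>\<open>\<hbar>\<omega>\<close>\<close>
  elastic_rate :: real               \<comment> \<open>\<open>c\<^sub>0\<close>\<close>
  inelastic_rate :: real             \<comment> \<open>\<open>K\<close>\<close>
  phonon_density :: real             \<comment> \<open>\<open>n\<^sub>p\<^sub>h\<close>\<close>


subsection \<open>Mesh and discrete space\<close>

definition nodes :: "real \<Rightarrow> real \<Rightarrow> nat \<Rightarrow> (nat \<Rightarrow> real) \<Rightarrow> bool" where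
  "nodes a b n s \<longleftrightarrow> s 0 = a \<and> s n = b \<and> strict_mono_on {0..n} s"

definition phase_domain :: "bp_data \<Rightarrow> (real \<times> real \<times> real) set" where
  "phase_domain D = {0..len D} \<times> {0..pmax D} \<times> {-1..1}"

definition cell :: "bp_data \<Rightarrow> nat \<Rightarrow> nat \<Rightarrow> nat \<Rightarrow> (real \<times> real \<times> real) set" where
  "cell D i k m = {xs D i..xs D (Suc i)} \<times> {ps D k..ps D (Suc k)} \<times> {ms D m..ms D (Suc m)}"

text \<open>The polynomial of total degree at most \<open>d\<close> in \<open>(x, p, \<mu>)\<close> with coefficients \<open>c\<close>.\<close>

definition poly3 :: "nat \<Rightarrow> (nat \<times> nat \<times> nat \<Rightarrow> real) \<Rightarrow> real \<times> real \<times> real \<Rightarrow> real" where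
  "poly3 d c = (\<lambda>(x, p, \<mu>).
     \<Sum>(a, b, e)\<in>{(a, b, e). a + b + e \<le> d}. c (a, b, e) * x ^ a * p ^ b * \<mu> ^ e)"

definition dg_space :: "bp_data \<Rightarrow> nat \<Rightarrow> (real \<times> real \<times> real \<Rightarrow> real) set" where
  "dg_space D d = {g. \<forall>i<nx D. \<forall>k<np D. \<forall>m<nm D.
     \<exists>c. \<forall>z\<in>interior (cell D i k m). g z = poly3 d c z}"

text \<open>
  A curve \<open>t \<mapsto> f t\<close> (\<open>t \<ge> 0\<close>) in the discrete space, differentiable in time, i.e. with
  differentiable coefficients on every cell.
\<close>

definition dg_curve :: "bp_data \<Rightarrow> nat \<Rightarrow> (real \<Rightarrow> real \<times> real \<times> real \<Rightarrow> real) \<Rightarrow> bool" where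
  "dg_curve D d f \<longleftrightarrow> (\<forall>i<nx D. \<forall>k<np D. \<forall>m<nm D.
     \<exists>c. (\<forall>\<alpha>. (\<lambda>t. c t \<alpha>) differentiable_on {0..}) \<and>
         (\<forall>t\<ge>0. \<forall>z\<in>interior (cell D i k m). f t z = poly3 d (c t) z))"

text \<open>One-sided at \<open>t = 0\<close>.\<close>

definition time_deriv ::
    "(real \<Rightarrow> real \<times> real \<times> real \<Rightarrow> real) \<Rightarrow> real \<Rightarrow> real \<times> real \<times> real \<Rightarrow> real" where
  "time_deriv f t z = vector_derivative (\<lambda>s. f s z) (at t within {0..})"


subsection \<open>Collision operator\<close>

definition inv_band :: "bp_data \<Rightarrow> real \<Rightarrow> real" where
  "inv_band D = the_inv_into {0..pmax D} (band D)"

definition cutoff :: "bp_data \<Rightarrow> real \<Rightarrow> real" where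
  "cutoff D e = (if 0 \<le> e \<and> e \<le> band D (pmax D) then 1 else 0)"

text \<open>\<open>p\<^sup>2(\<epsilon>) (dp/d\<epsilon>) \<chi>(\<epsilon>)\<close>\<close>

definition dos :: "bp_data \<Rightarrow> real \<Rightarrow> real" where
  "dos D e = (inv_band D e)\<^sup>2 * deriv (inv_band D) e * cutoff D e"

definition rate :: "bp_data \<Rightarrow> int \<Rightarrow> real" where
  "rate D j =
     (if j = 1 then (phonon_density D + 1) * inelastic_rate D
      else if j = -1 then phonon_density D * inelastic_rate D
      else elastic_rate D)"

text \<open>
  The collision operator acts on functions of \<open>(p, \<mu>)\<close>, i.e. on azimuthally symmetric functions of
  the momentum, at fixed \<open>x\<close> and \<open>t\<close>.
\<close>

definition collision :: "bp_data \<Rightarrow> (real \<times> real \<Rightarrow> real) \<Rightarrow> real \<times> real \<Rightarrow> real" where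
  "collision D F = (\<lambda>(p, \<mu>).
     2 * pi * (\<Sum>j\<in>{-1..1::int}. rate D j *
        (let e' = band D p + of_int j * phonon_energy D
         in integral {-1..1} (\<lambda>\<mu>'. F (inv_band D e', \<mu>') * dos D e')))
     - 4 * pi * F (p, \<mu>) * (\<Sum>j\<in>{-1..1::int}. rate D j *
        dos D (band D p - of_int j * phonon_energy D)))"

text \<open>
  The dissipative property
  \[ \int Q(f) g \, d\vec p = -\frac12 \int\!\int S(\vec p\,' \to \vec p) e^{-\varepsilon(p')}
     \Big(\frac{f'}{e^{-\varepsilon(p')}} - \frac{f}{e^{-\varepsilon(p)}}\Big)
     (g' - g) \, d\vec p\,' \, d\vec p \]
  for azimuthally symmetric \<open>f, g\<close>. Each azimuthal angle contributes a factor \<open>2 \<pi>\<close>, and the factor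
  \<open>\<delta>(\<epsilon>(p') - \<epsilon>(p) - j \<hbar>\<omega>)\<close> of the kernel is integrated out in \<open>p'\<close>: it sets \<open>\<epsilon>(p') = e'\<close> and
  turns \<open>p'\<^sup>2 dp'\<close> into \<open>p\<^sup>2(e') (dp/de') \<chi>(e')\<close>.
\<close>

definition dissipative :: "bp_data \<Rightarrow> bool" where
  "dissipative D \<longleftrightarrow> (\<forall>F G :: real \<times> real \<Rightarrow> real.
     F \<in> borel_measurable borel \<and> bounded (range F) \<and>
     G \<in> borel_measurable borel \<and> bounded (range G) \<longrightarrow>
     2 * pi * integral ({0..pmax D} \<times> {-1..1})
        (\<lambda>(p, \<mu>). collision D F (p, \<mu>) * G (p, \<mu>) * p\<^sup>2)
     = - (1 / 2) * (2 * pi)\<^sup>2 * (\<Sum>j\<in>{-1..1::int}. rate D j *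
        integral ({0..pmax D} \<times> {-1..1} \<times> {-1..1}) (\<lambda>(p, \<mu>, \<mu>').
          let e' = band D p + of_int j * phonon_energy D; p' = inv_band D e'
          in dos D e' * exp (- e') *
             (F (p', \<mu>') / exp (- e') - F (p, \<mu>) / exp (- band D p)) *
             (G (p', \<mu>') - G (p, \<mu>)) * p\<^sup>2)))"


subsection \<open>The model\<close>

text \<open>
  The band energy is measured from the bottom of the band, \<open>\<epsilon>(0) = 0\<close>, so that \<open>p(\<epsilon>)\<close> is defined
  exactly on the support \<open>[0, \<epsilon>\<^sub>m\<^sub>a\<^sub>x]\<close> of the cutoff.
\<close>

definition bp_model :: "bp_data \<Rightarrow> bool" where
  "bp_model D \<longleftrightarrow>
     0 < len D \<and> 0 < pmax D \<and>
     nodes 0 (len D) (nx D) (xs D) \<and>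
     nodes 0 (pmax D) (np D) (ps D) \<and>
     nodes (-1) 1 (nm D) (ms D) \<and>
     (\<forall>n. \<forall>p\<in>{0..pmax D}. (deriv ^^ n) (band D) field_differentiable at p) \<and>
     (\<forall>p\<in>{0..pmax D}. 0 < deriv (band D) p) \<and>
     band D 0 = 0 \<and>
     0 < charge D \<and> 0 < permittivity D \<and> 0 < phonon_energy D \<and>
     0 \<le> elastic_rate D \<and> 0 \<le> inelastic_rate D \<and> 0 \<le> phonon_density D \<and>
     dissipative D"

definition efield :: "bp_data \<Rightarrow> (real \<Rightarrow> real \<Rightarrow> real) \<Rightarrow> real \<Rightarrow> real \<Rightarrow> real" where
  "efield D V x t = - vector_derivative (\<lambda>y. V y t) (at x within {0..len D})"

text \<open>
  \<open>V(x, t)\<close> is periodic in \<open>x\<close> and solves \<open>-\<partial>\<^sub>x\<^sup>2 V = \<partial>\<^sub>x E = (q / \<epsilon>) (N - 2 \<pi> \<integral>\<integral> f p\<^sup>2 dp d\<mu>)\<close>. As \<open>f\<close>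
  jumps at the nodes and \<open>N\<close> may jump as well, \<open>V\<close> is continuously differentiable and the second
  derivative is required off a finite set.
\<close>

definition poisson ::
    "bp_data \<Rightarrow> (real \<Rightarrow> real \<Rightarrow> real) \<Rightarrow> (real \<Rightarrow> real \<times> real \<times> real \<Rightarrow> real) \<Rightarrow> bool" where
  "poisson D V f \<longleftrightarrow> (\<forall>t\<ge>0.
     (\<lambda>x. V x t) differentiable_on {0..len D} \<and>
     continuous_on {0..len D} (\<lambda>x. efield D V x t) \<and>
     V 0 t = V (len D) t \<and>
     (\<exists>S. finite S \<and> (\<forall>x\<in>{0..len D} - S.
        ((\<lambda>y. efield D V y t) has_real_derivative
           charge D / permittivity D *
             (doping D x - 2 * pi * integral {-1..1} (\<lambda>\<mu>.
                integral {0..pmax D} (\<lambda>p. f t (x, p, \<mu>) * p\<^sup>2))))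
          (at x within {0..len D}))))"

definition hamiltonian ::
    "bp_data \<Rightarrow> (real \<Rightarrow> real \<Rightarrow> real) \<Rightarrow> real \<Rightarrow> real \<Rightarrow> real \<Rightarrow> real" where
  "hamiltonian D V x p t = band D p - charge D * V x t"


subsection \<open>The DG formulation\<close>

text \<open>
  One-sided limits at the face \<open>y\<close> from below and from above, in a direction with period cell
  \<open>[a, b]\<close>: the faces \<open>a\<close> and \<open>b\<close> are identified.
\<close>

definition trace_below :: "real \<Rightarrow> real \<Rightarrow> (real \<Rightarrow> real) \<Rightarrow> real \<Rightarrow> real" where
  "trace_below a b F y = Lim (at_left (if y = a then b else y)) F"

definition trace_above :: "real \<Rightarrow> real \<Rightarrow> (real \<Rightarrow> real) \<Rightarrow> real \<Rightarrow> real" where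
  "trace_above a b F y = Lim (at_right (if y = b then a else y)) F"

definition upwind :: "real \<Rightarrow> real \<Rightarrow> real \<Rightarrow> real" where
  "upwind v u_below u_above = (v + \<bar>v\<bar>) / 2 * u_below + (v - \<bar>v\<bar>) / 2 * u_above"

definition flux_x ::
    "bp_data \<Rightarrow> (real \<times> real \<times> real \<Rightarrow> real) \<Rightarrow> real \<Rightarrow> real \<Rightarrow> real \<Rightarrow> real" where
  "flux_x D u x p \<mu> = upwind \<mu>
     (trace_below 0 (len D) (\<lambda>y. u (y, p, \<mu>)) x)
     (trace_above 0 (len D) (\<lambda>y. u (y, p, \<mu>)) x)"

text \<open>
  In the \<open>p\<close> direction one of the two factors of the face weight \<open>p\<^sub>k\<^sup>2\<close> is carried by the traces; the
  other one belongs to the test function and appears in the formulation below. At a face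
  \<open>0 < p\<^sub>k < p\<^sub>m\<^sub>a\<^sub>x\<close> the weight is continuous, and \<open>p\<^sub>k * flux_p\<close> is \<open>p\<^sub>k\<^sup>2\<close> times the upwind flux of
  \<open>u\<close>. At the identified pair \<open>p = 0\<close>, \<open>p = p\<^sub>m\<^sub>a\<^sub>x\<close> the weight \<open>p\<^sup>2\<close> of the phase-space measure is
  not periodic, and the periodic identification is the one of \<open>p u\<close>, whose square is the density of
  \<open>u\<^sup>2\<close> with respect to \<open>dp\<close>; thus every face, identified or not, obeys the same formula. (Wrapping
  \<open>u\<close> itself would feed its trace at \<open>p = 0\<close>, where the cell carries no weight, into \<open>p = p\<^sub>m\<^sub>a\<^sub>x\<close> with
  the weight \<open>p\<^sub>m\<^sub>a\<^sub>x\<^sup>2\<close>; that scheme is not stable.) In the directions \<open>x\<close> and \<open>\<mu>\<close> the weights take the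
  same value on opposite faces.
\<close>

definition flux_p ::
    "bp_data \<Rightarrow> (real \<Rightarrow> real) \<Rightarrow> (real \<times> real \<times> real \<Rightarrow> real) \<Rightarrow> real \<Rightarrow> real \<Rightarrow> real \<Rightarrow> real" where
  "flux_p D E u x p \<mu> = upwind (- charge D * E x * \<mu>)
     (trace_below 0 (pmax D) (\<lambda>r. r * u (x, r, \<mu>)) p)
     (trace_above 0 (pmax D) (\<lambda>r. r * u (x, r, \<mu>)) p)"

definition flux_mu ::
    "bp_data \<Rightarrow> (real \<Rightarrow> real) \<Rightarrow> (real \<times> real \<times> real \<Rightarrow> real) \<Rightarrow> real \<Rightarrow> real \<Rightarrow> real \<Rightarrow> real" where
  "flux_mu D E u x p \<mu> = upwind (- charge D * E x)
     (trace_below (-1) 1 (\<lambda>n. u (x, p, n)) \<mu>)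
     (trace_above (-1) 1 (\<lambda>n. u (x, p, n)) \<mu>)"

text \<open>
  The semi-discrete weak form on one cell at a fixed time: \<open>u\<close> is \<open>f\<^sub>h\<close>, \<open>u'\<close> is \<open>\<partial>\<^sub>t f\<^sub>h\<close>, \<open>g\<close> is the
  test function, \<open>E\<close> the field and \<open>H x p\<close> the Hamiltonian at that time.
\<close>

definition dg_equation ::
    "bp_data \<Rightarrow> (real \<Rightarrow> real) \<Rightarrow> (real \<Rightarrow> real \<Rightarrow> real) \<Rightarrow>
     (real \<times> real \<times> real \<Rightarrow> real) \<Rightarrow> (real \<times> real \<times> real \<Rightarrow> real) \<Rightarrow>
     (real \<times> real \<times> real \<Rightarrow> real) \<Rightarrow> nat \<Rightarrow> nat \<Rightarrow> nat \<Rightarrow> bool" where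
  "dg_equation D E H u u' g i k m \<longleftrightarrow>
    (let q = charge D;
         xl = xs D i; xr = xs D (Suc i);
         pl = ps D k; pr = ps D (Suc k);
         ml = ms D m; mr = ms D (Suc m);
         w = (\<lambda>x p \<mu>. g (x, p, \<mu>) * exp (H x p))
     in
       integral (cell D i k m) (\<lambda>(x, p, \<mu>). u' (x, p, \<mu>) * w x p \<mu> * p\<^sup>2)

     - integral (cell D i k m) (\<lambda>(x, p, \<mu>).
         deriv (band D) p * u (x, p, \<mu>) * \<mu> * deriv (\<lambda>y. w y p \<mu>) x * p\<^sup>2)
     + integral ({pl..pr} \<times> {ml..mr}) (\<lambda>(p, \<mu>).
         deriv (band D) p * flux_x D u xr p \<mu> * Lim (at_left xr) (\<lambda>y. w y p \<mu>) * p\<^sup>2)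
     - integral ({pl..pr} \<times> {ml..mr}) (\<lambda>(p, \<mu>).
         deriv (band D) p * flux_x D u xl p \<mu> * Lim (at_right xl) (\<lambda>y. w y p \<mu>) * p\<^sup>2)

     - integral (cell D i k m) (\<lambda>(x, p, \<mu>).
         p\<^sup>2 * (- q * E x) * u (x, p, \<mu>) * \<mu> * deriv (\<lambda>r. w x r \<mu>) p)
     + integral ({xl..xr} \<times> {ml..mr}) (\<lambda>(x, \<mu>).
         pr * flux_p D E u x pr \<mu> * Lim (at_left pr) (\<lambda>r. w x r \<mu>))
     - integral ({xl..xr} \<times> {ml..mr}) (\<lambda>(x, \<mu>).
         pl * flux_p D E u x pl \<mu> * Lim (at_right pl) (\<lambda>r. w x r \<mu>))

     - integral (cell D i k m) (\<lambda>(x, p, \<mu>).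
         (1 - \<mu>\<^sup>2) * u (x, p, \<mu>) * (- q * E x) * deriv (\<lambda>n. w x p n) \<mu> * p)
     + integral ({xl..xr} \<times> {pl..pr}) (\<lambda>(x, p).
         (1 - mr\<^sup>2) * flux_mu D E u x p mr * Lim (at_left mr) (\<lambda>n. w x p n) * p)
     - integral ({xl..xr} \<times> {pl..pr}) (\<lambda>(x, p).
         (1 - ml\<^sup>2) * flux_mu D E u x p ml * Lim (at_right ml) (\<lambda>n. w x p n) * p)

     = integral (cell D i k m) (\<lambda>(x, p, \<mu>).
         collision D (\<lambda>(p', \<mu>'). u (x, p', \<mu>')) (p, \<mu>) * w x p \<mu> * p\<^sup>2))"

definition dg_solution ::
    "bp_data \<Rightarrow> nat \<Rightarrow> (real \<Rightarrow> real \<Rightarrow> real) \<Rightarrow> (real \<Rightarrow> real \<times> real \<times> real \<Rightarrow> real) \<Rightarrow> bool" where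
  "dg_solution D d V f \<longleftrightarrow>
     dg_curve D d f \<and> poisson D V f \<and>
     (\<forall>t\<ge>0. \<forall>g\<in>dg_space D d. \<forall>i<nx D. \<forall>k<np D. \<forall>m<nm D.
        dg_equation D (\<lambda>x. efield D V x t) (\<lambda>x p. hamiltonian D V x p t)
          (f t) (time_deriv f t) g i k m)"

end

(*
  Test with g = f_h. As the transport field annihilates H(., t) and is divergence-free with respect
  to p^2 dx dp dmu, the volume terms on each cell equal minus one half of the boundary flux of
  f_h^2 e^H. Summed over the periodic mesh, the upwind fluxes leave at every face the nonnegative
  term |v| [f_h]^2 e^H / 2. The collision term is nonpositive by dissipativity, applied for fixed x
  to F = f_h and G = f_h e^{eps}: there F' / e^{-eps'} - F / e^{-eps} = G' - G, so the integrand is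
  a square.
*)
theory Submission
  imports Defs
begin

text \<open>The transport field is (\<epsilon>' \<mu>, -q E \<mu>, -q E (1 - \<mu>^2) / p). Its
  divergence with respect to p^2 vanishes because the term -2 q E p \<mu> of the p component cancels
  against the \<mu> component, and it annihilates H because H_x = q E. The cancellations thus take
  place between the three volume integrals, none of which reduces to faces on its own. Two obstacles
  shape the rest. First, e^H is not periodic in p; the balance at the identified faces survives
  because the flux in p uses the traces of p f_h, which vanish at p = 0. Second,
  \<open>dissipative\<close> speaks of bounded Borel functions of (p, \<mu>), while f_h is arbitrary
  on the mesh faces and the gain term evaluates it along a line p' = p(e'), which is a null set.
  Hence f_h is replaced by a Borel function \<open>U\<close>, and the finitely many momenta from
  which a phonon shift meets a node are removed. Dissipativity acts on one slice in x, where the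
  factor e^(-q V) of e^H is constant; Fubini carries the sign to the whole domain, which requires
  joint measurability and bounds.\<close>

subsection \<open>Upwind fluxes on a periodic mesh\<close>

definition nxt :: "nat \<Rightarrow> nat \<Rightarrow> nat" where
  "nxt n i = (if Suc i = n then 0 else Suc i)"

definition prv :: "nat \<Rightarrow> nat \<Rightarrow> nat" where
  "prv n i = (if i = 0 then n - 1 else i - 1)"

lemma nxt_less: "i < n \<Longrightarrow> nxt n i < n"
  by (auto simp: nxt_def)

lemma prv_less: "i < n \<Longrightarrow> prv n i < n"
  by (auto simp: prv_def)

lemma prv_nxt: "i < n \<Longrightarrow> prv n (nxt n i) = i"
  by (auto simp: nxt_def prv_def)

lemma nxt_prv: "i < n \<Longrightarrow> nxt n (prv n i) = i"
  by (auto simp: nxt_def prv_def)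

lemma bij_betw_nxt: "bij_betw (nxt n) {..<n} {..<n}"
  by (rule bij_betw_byWitness[where f' = "prv n"])
    (auto simp: prv_nxt nxt_prv nxt_less prv_less)

text \<open>The upwind flux is v times the mean of the two traces plus \<bar>v\<bar> / 2 times the
  jump \<open>a - b\<close>. Multiplied by the jump, the mean produces the difference of squares
  that is subtracted here, and the second part is the numerical dissipation.\<close>

lemma upwind_jump:
  "upwind v a b * (a - b) - v / 2 * (a\<^sup>2 - b\<^sup>2) = \<bar>v\<bar> / 2 * (a - b)\<^sup>2"
  by (simp add: upwind_def field_simps power2_eq_square)

text \<open>
  \<open>a i\<close> and \<open>b i\<close> are the traces of cell \<open>i\<close> at its upper and lower face. The weights on the two
  sides of a face may differ where the trace \<open>b\<close> vanishes: this is the identified pair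
  \<open>p = p\<^sub>m\<^sub>a\<^sub>x\<close>, \<open>p = 0\<close>, at which \<open>exp H\<close> is not periodic but the trace of \<open>p u\<close> at \<open>p = 0\<close> is zero.
\<close>

lemma upwind_cyclic_sum_nonneg:
  fixes a b e e' :: "nat \<Rightarrow> real"
  assumes e: "\<And>i. i < n \<Longrightarrow> 0 \<le> e i"
    and e': "\<And>i. i < n \<Longrightarrow> b (nxt n i) = 0 \<or> e' (nxt n i) = e i"
  shows "0 \<le> (\<Sum>i<n. upwind v (a i) (b (nxt n i)) * a i * e i
                 - upwind v (a (prv n i)) (b i) * b i * e' i
                 - v / 2 * ((a i)\<^sup>2 * e i - (b i)\<^sup>2 * e' i))"
proof -
  \<comment> \<open>The share of the lower face of cell \<open>i\<close>. Reindexing by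
    \<open>nxt\<close> moves it to the upper face of the preceding cell, so that both contributions
    of a face appear under the same index.\<close>
  define \<beta> where "\<beta> i = upwind v (a (prv n i)) (b i) * b i * e' i - v / 2 * ((b i)\<^sup>2 * e' i)" for i
  have "(\<Sum>i<n. \<beta> i) = (\<Sum>i<n. \<beta> (nxt n i))"
    by (rule sum.reindex_bij_betw[OF bij_betw_nxt, symmetric])
  \<comment> \<open>The weight \<open>e'\<close> of the lower side becomes \<open>e\<close> of the
    upper side: every term carries a factor \<open>b (nxt n i)\<close>, so where the weights may
    differ both sides are zero.\<close>
  also have "\<dots> = (\<Sum>i<n. (upwind v (a i) (b (nxt n i)) * b (nxt n i) - v / 2 * (b (nxt n i))\<^sup>2) * e i)"
  proof (rule sum.cong[OF refl])
    fix i assume "i \<in> {..<n}"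
    then show "\<beta> (nxt n i) = (upwind v (a i) (b (nxt n i)) * b (nxt n i) - v / 2 * (b (nxt n i))\<^sup>2) * e i"
      using e'[of i] by (auto simp: \<beta>_def prv_nxt algebra_simps)
  qed
  finally have \<beta>: "(\<Sum>i<n. \<beta> i) = \<dots>" .
  have "(\<Sum>i<n. upwind v (a i) (b (nxt n i)) * a i * e i
                 - upwind v (a (prv n i)) (b i) * b i * e' i
                 - v / 2 * ((a i)\<^sup>2 * e i - (b i)\<^sup>2 * e' i))
      = (\<Sum>i<n. (upwind v (a i) (b (nxt n i)) * a i - v / 2 * (a i)\<^sup>2) * e i) - (\<Sum>i<n. \<beta> i)"
    by (simp add: sum_subtractf[symmetric] \<beta>_def algebra_simps)
  also have "\<dots> = (\<Sum>i<n. \<bar>v\<bar> / 2 * (a i - b (nxt n i))\<^sup>2 * e i)"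
    unfolding \<beta> sum_subtractf[symmetric] upwind_jump[symmetric]
    by (simp add: algebra_simps)
  also have "0 \<le> \<dots>"
    using e by (intro sum_nonneg mult_nonneg_nonneg) auto
  finally show ?thesis .
qed

text \<open>The summand of \<open>upwind_cyclic_sum_nonneg\<close> as a function of the cell index.
  A single summand has no sign; only the sum around the period does.\<close>

definition jump :: "nat \<Rightarrow> real \<Rightarrow> (nat \<Rightarrow> real) \<Rightarrow> (nat \<Rightarrow> real) \<Rightarrow> (nat \<Rightarrow> real) \<Rightarrow> (nat \<Rightarrow> real) \<Rightarrow> nat \<Rightarrow> real" where
  "jump n v a b e e' i = upwind v (a i) (b (nxt n i)) * a i * e i
     - upwind v (a (prv n i)) (b i) * b i * e' i - v / 2 * ((a i)\<^sup>2 * e i - (b i)\<^sup>2 * e' i)"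

subsection \<open>Integrals over bricks\<close>

lemma box_Times: "box (a, c) (b, d) = box a b \<times> box c d"
  for a b :: "'a::euclidean_space" and c d :: "'b::euclidean_space"
  by (force simp: box_def Basis_prod_def)

lemma cbox_rect: "{a..b} \<times> {c..d} = cbox (a, c) (b, d)" for a b c d :: real
  by (simp add: cbox_Pair_eq)

lemma cbox_brick: "{a..b} \<times> {c..d} \<times> {e..f} = cbox (a, c, e) (b, d, f)" for a b c d e f :: real
  by (simp add: cbox_Pair_eq)

lemma integral_cbox_cong_interior:
  assumes "\<And>z. z \<in> box a b \<Longrightarrow> f z = g z"
  shows "integral (cbox a b) f = integral (cbox a b) g"
  by (rule integral_spike[OF negligible_frontier_interval[of a b]]) (use assms in auto)

lemma integral_rect_cong:
  fixes a b c d :: real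
  assumes "\<And>x y. \<lbrakk>a < x; x < b; c < y; y < d\<rbrakk> \<Longrightarrow> f (x, y) = g (x, y)"
  shows "integral ({a..b} \<times> {c..d}) f = integral ({a..b} \<times> {c..d}) g"
  unfolding cbox_rect using assms by (intro integral_cbox_cong_interior) (auto simp: box_Times)

lemma integral_brick_cong:
  fixes a b c d e h :: real
  assumes "\<And>x y z. \<lbrakk>a < x; x < b; c < y; y < d; e < z; z < h\<rbrakk> \<Longrightarrow> f (x, y, z) = g (x, y, z)"
  shows "integral ({a..b} \<times> {c..d} \<times> {e..h}) f = integral ({a..b} \<times> {c..d} \<times> {e..h}) g"
  unfolding cbox_brick using assms by (intro integral_cbox_cong_interior) (auto simp: box_Times)

lemma integrable_rect:
  fixes f :: "real \<times> real \<Rightarrow> real"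
  shows "continuous_on ({a..b} \<times> {c..d}) f \<Longrightarrow> f integrable_on {a..b} \<times> {c..d}"
  unfolding cbox_rect by (rule integrable_continuous)

lemma integrable_brick:
  fixes f :: "real \<times> real \<times> real \<Rightarrow> real"
  shows "continuous_on ({a..b} \<times> {c..d} \<times> {e..h}) f \<Longrightarrow> f integrable_on {a..b} \<times> {c..d} \<times> {e..h}"
  unfolding cbox_brick by (rule integrable_continuous)

text \<open>Fubini is used in the order that makes the differentiated coordinate the inner one,
  where the fundamental theorem of calculus applies.\<close>

lemma integral_deriv_fst:
  fixes A A' :: "real \<times> 'b::euclidean_space \<Rightarrow> real"
  assumes "continuous_on (cbox (x0, c) (x1, d)) A'" and "x0 \<le> x1"
    and "\<And>x y. x \<in> {x0..x1} \<Longrightarrow> y \<in> cbox c d \<Longrightarrow>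
      ((\<lambda>s. A (s, y)) has_real_derivative A' (x, y)) (at x within {x0..x1})"
  shows "integral (cbox (x0, c) (x1, d)) A' = integral (cbox c d) (\<lambda>y. A (x1, y) - A (x0, y))"
proof -
  have "integral (cbox (x0, c) (x1, d)) A' = integral (cbox x0 x1) (\<lambda>x. integral (cbox c d) (\<lambda>y. A' (x, y)))"
    by (rule integral_prod_continuous[OF assms(1)])
  also have "\<dots> = integral (cbox c d) (\<lambda>y. integral (cbox x0 x1) (\<lambda>x. A' (x, y)))"
    using assms(1) by (intro integral_swap_continuous) simp
  also have "\<dots> = integral (cbox c d) (\<lambda>y. A (x1, y) - A (x0, y))"
  proof (rule integral_cong)
    fix y assume "y \<in> cbox c d"
    then have "((\<lambda>x. A' (x, y)) has_integral A (x1, y) - A (x0, y)) {x0..x1}"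
      using assms by (intro fundamental_theorem_of_calculus)
        (auto simp: has_real_derivative_iff_has_vector_derivative)
    then show "integral (cbox x0 x1) (\<lambda>x. A' (x, y)) = A (x1, y) - A (x0, y)"
      by auto
  qed
  finally show ?thesis .
qed

lemma integral_deriv_snd:
  fixes A A' :: "'b::euclidean_space \<times> real \<Rightarrow> real"
  assumes "continuous_on (cbox (c, x0) (d, x1)) A'" and "x0 \<le> x1"
    and "\<And>x y. x \<in> {x0..x1} \<Longrightarrow> y \<in> cbox c d \<Longrightarrow>
      ((\<lambda>s. A (y, s)) has_real_derivative A' (y, x)) (at x within {x0..x1})"
  shows "integral (cbox (c, x0) (d, x1)) A' = integral (cbox c d) (\<lambda>y. A (y, x1) - A (y, x0))"
proof -
  have "integral (cbox (c, x0) (d, x1)) A' = integral (cbox c d) (\<lambda>y. integral (cbox x0 x1) (\<lambda>x. A' (y, x)))"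
    by (rule integral_prod_continuous[OF assms(1)])
  also have "\<dots> = integral (cbox c d) (\<lambda>y. A (y, x1) - A (y, x0))"
  proof (rule integral_cong)
    fix y assume "y \<in> cbox c d"
    then have "((\<lambda>x. A' (y, x)) has_integral A (y, x1) - A (y, x0)) {x0..x1}"
      using assms by (intro fundamental_theorem_of_calculus)
        (auto simp: has_real_derivative_iff_has_vector_derivative)
    then show "integral (cbox x0 x1) (\<lambda>x. A' (y, x)) = A (y, x1) - A (y, x0)"
      by auto
  qed
  finally show ?thesis .
qed

lemma integral_brick_deriv_1:
  fixes A A' :: "real \<times> real \<times> real \<Rightarrow> real"
  assumes "continuous_on ({x0..x1} \<times> {p0..p1} \<times> {m0..m1}) A'" and "x0 \<le> x1"
    and "\<And>x p m. \<lbrakk>x \<in> {x0..x1}; p \<in> {p0..p1}; m \<in> {m0..m1}\<rbrakk> \<Longrightarrow>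
      ((\<lambda>s. A (s, p, m)) has_real_derivative A' (x, p, m)) (at x within {x0..x1})"
  shows "integral ({x0..x1} \<times> {p0..p1} \<times> {m0..m1}) A'
    = integral ({p0..p1} \<times> {m0..m1}) (\<lambda>(p, m). A (x1, p, m) - A (x0, p, m))"
proof -
  have "integral (cbox (x0, p0, m0) (x1, p1, m1)) A'
      = integral (cbox (p0, m0) (p1, m1)) (\<lambda>y. A (x1, y) - A (x0, y))"
    using assms by (intro integral_deriv_fst) (auto simp: cbox_brick)
  then show ?thesis by (simp add: cbox_brick[symmetric] cbox_rect[symmetric] case_prod_unfold)
qed

text \<open>The first coordinate is split off, which leaves \<open>integral_deriv_fst\<close> on
  each slice. Continuity of \<open>A\<close> itself serves to reassemble the slices into one double
  integral over the face; for the first coordinate the face integral comes out whole.\<close>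

lemma integral_brick_deriv_2:
  fixes A A' :: "real \<times> real \<times> real \<Rightarrow> real"
  assumes A': "continuous_on ({x0..x1} \<times> {p0..p1} \<times> {m0..m1}) A'" and "p0 \<le> p1"
    and A: "continuous_on ({x0..x1} \<times> {p0..p1} \<times> {m0..m1}) A"
    and deriv: "\<And>x p m. \<lbrakk>x \<in> {x0..x1}; p \<in> {p0..p1}; m \<in> {m0..m1}\<rbrakk> \<Longrightarrow>
      ((\<lambda>s. A (x, s, m)) has_real_derivative A' (x, p, m)) (at p within {p0..p1})"
  shows "integral ({x0..x1} \<times> {p0..p1} \<times> {m0..m1}) A'
    = integral ({x0..x1} \<times> {m0..m1}) (\<lambda>(x, m). A (x, p1, m) - A (x, p0, m))"
proof -
  have "integral (cbox (x0, p0, m0) (x1, p1, m1)) A'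
      = integral (cbox x0 x1) (\<lambda>x. integral (cbox (p0, m0) (p1, m1)) (\<lambda>y. A' (x, y)))"
    using A' by (intro integral_prod_continuous) (simp add: cbox_brick)
  also have "\<dots> = integral (cbox x0 x1) (\<lambda>x. integral (cbox m0 m1) (\<lambda>m. A (x, p1, m) - A (x, p0, m)))"
  proof (rule integral_cong)
    fix x assume x: "x \<in> cbox x0 x1"
    have "continuous_on (cbox (p0, m0) (p1, m1)) (\<lambda>y. A' (x, y))"
      by (rule continuous_on_compose2[OF A']) (use x in \<open>auto intro!: continuous_intros\<close>)
    then show "integral (cbox (p0, m0) (p1, m1)) (\<lambda>y. A' (x, y))
        = integral (cbox m0 m1) (\<lambda>m. A (x, p1, m) - A (x, p0, m))"
      using assms x by (subst integral_deriv_fst[where A = "\<lambda>y. A (x, y)"]) auto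
  qed
  also have "\<dots> = integral (cbox (x0, m0) (x1, m1)) (\<lambda>(x, m). A (x, p1, m) - A (x, p0, m))"
  proof (subst integral_prod_continuous)
    show "continuous_on (cbox (x0, m0) (x1, m1)) (\<lambda>(x, m). A (x, p1, m) - A (x, p0, m))"
      unfolding split_beta
      by (intro continuous_intros continuous_on_compose2[OF A])
        (use \<open>p0 \<le> p1\<close> in \<open>auto simp: cbox_rect[symmetric]\<close>)
  qed simp
  finally show ?thesis by (simp only: cbox_brick[symmetric] cbox_rect[symmetric])
qed

lemma integral_brick_deriv_3:
  fixes A A' :: "real \<times> real \<times> real \<Rightarrow> real"
  assumes A': "continuous_on ({x0..x1} \<times> {p0..p1} \<times> {m0..m1}) A'" and "m0 \<le> m1"
    and A: "continuous_on ({x0..x1} \<times> {p0..p1} \<times> {m0..m1}) A"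
    and deriv: "\<And>x p m. \<lbrakk>x \<in> {x0..x1}; p \<in> {p0..p1}; m \<in> {m0..m1}\<rbrakk> \<Longrightarrow>
      ((\<lambda>s. A (x, p, s)) has_real_derivative A' (x, p, m)) (at m within {m0..m1})"
  shows "integral ({x0..x1} \<times> {p0..p1} \<times> {m0..m1}) A'
    = integral ({x0..x1} \<times> {p0..p1}) (\<lambda>(x, p). A (x, p, m1) - A (x, p, m0))"
proof -
  have "integral (cbox (x0, p0, m0) (x1, p1, m1)) A'
      = integral (cbox x0 x1) (\<lambda>x. integral (cbox (p0, m0) (p1, m1)) (\<lambda>y. A' (x, y)))"
    using A' by (intro integral_prod_continuous) (simp add: cbox_brick)
  also have "\<dots> = integral (cbox x0 x1) (\<lambda>x. integral (cbox p0 p1) (\<lambda>p. A (x, p, m1) - A (x, p, m0)))"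
  proof (rule integral_cong)
    fix x assume x: "x \<in> cbox x0 x1"
    have "continuous_on (cbox (p0, m0) (p1, m1)) (\<lambda>y. A' (x, y))"
      by (rule continuous_on_compose2[OF A']) (use x in \<open>auto intro!: continuous_intros\<close>)
    then show "integral (cbox (p0, m0) (p1, m1)) (\<lambda>y. A' (x, y))
        = integral (cbox p0 p1) (\<lambda>p. A (x, p, m1) - A (x, p, m0))"
      using assms x by (subst integral_deriv_snd[where A = "\<lambda>y. A (x, y)"]) auto
  qed
  also have "\<dots> = integral (cbox (x0, p0) (x1, p1)) (\<lambda>(x, p). A (x, p, m1) - A (x, p, m0))"
  proof (subst integral_prod_continuous)
    show "continuous_on (cbox (x0, p0) (x1, p1)) (\<lambda>(x, p). A (x, p, m1) - A (x, p, m0))"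
      unfolding split_beta
      by (intro continuous_intros continuous_on_compose2[OF A])
        (use \<open>m0 \<le> m1\<close> in \<open>auto simp: cbox_rect[symmetric]\<close>)
  qed simp
  finally show ?thesis by (simp only: cbox_brick[symmetric] cbox_rect[symmetric])
qed

lemma integral_combine3:
  fixes f1 f2 f3 :: "real \<times> real \<Rightarrow> real"
  assumes "f1 integrable_on S" "f2 integrable_on S" "f3 integrable_on S" "\<And>z. z \<in> S \<Longrightarrow> f1 z - f2 z - f3 z = g z"
  shows "integral S f1 - integral S f2 - integral S f3 = integral S g"
proof -
  have "integral S f1 - integral S f2 - integral S f3 = integral S (\<lambda>z. f1 z - f2 z - f3 z)"
    using assms by (simp add: integral_diff integrable_diff)
  also have "\<dots> = integral S g" by (rule integral_cong) (rule assms)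
  finally show ?thesis .
qed

lemma negligible_coordinate:
  fixes A :: "real set"
  assumes "finite A"
  shows "negligible {z :: real \<times> 'b::euclidean_space. fst z \<in> A}"
    and "negligible {z :: real \<times> real. snd z \<in> A}"
    and "negligible {z :: real \<times> real \<times> real. fst (snd z) \<in> A}"
    and "negligible {z :: real \<times> real \<times> real. snd (snd z) \<in> A}"
proof -
  have *: "negligible {z :: 'c::euclidean_space. z \<bullet> b \<in> A}" if "b \<in> Basis" for b
  proof -
    have "{z. z \<bullet> b \<in> A} = (\<Union>a\<in>A. {z. z \<bullet> b = a})" by auto
    then show ?thesis
      using assms that by (auto intro!: negligible_Union negligible_standard_hyperplane)
  qed
  show "negligible {z :: real \<times> 'b. fst z \<in> A}"
    using *[of "(1, 0) :: real \<times> 'b"] by (simp add: Basis_prod_def inner_prod_def)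
  show "negligible {z :: real \<times> real. snd z \<in> A}"
    using *[of "(0, 1) :: real \<times> real"] by (simp add: Basis_prod_def inner_prod_def)
  show "negligible {z :: real \<times> real \<times> real. fst (snd z) \<in> A}"
    using *[of "(0, 1, 0) :: real \<times> real \<times> real"] by (simp add: Basis_prod_def inner_prod_def)
  show "negligible {z :: real \<times> real \<times> real. snd (snd z) \<in> A}"
    using *[of "(0, 0, 1) :: real \<times> real \<times> real"] by (simp add: Basis_prod_def inner_prod_def)
qed

text \<open>Stated without integrability, since \<open>dissipative\<close> provides none for its
  right-hand side: the integral of a function that is not integrable is 0 by default.\<close>

lemma integral_nonneg_off_negligible:
  fixes f :: "'a::euclidean_space \<Rightarrow> real"
  assumes "negligible N" "\<And>z. z \<in> S - N \<Longrightarrow> 0 \<le> f z"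
  shows "0 \<le> integral S f"
proof -
  let ?g = "\<lambda>z. if z \<in> N then 0 else f z"
  have "integral S f = integral S ?g"
    by (rule integral_spike[OF assms(1)]) auto
  moreover have "0 \<le> integral S ?g"
    using assms(2) by (cases "?g integrable_on S") (auto intro!: integral_nonneg simp: not_integrable_integral)
  ultimately show ?thesis by simp
qed

lemma measurable_indicator_mult:
  fixes f :: "real \<Rightarrow> real"
  shows "continuous_on {a..b} f \<Longrightarrow> (\<lambda>x. indicator {a..b} x * f x) \<in> borel_measurable borel"
  using borel_measurable_continuous_on_indicator[of "{a..b}" f] by simp

lemma integrable_bounded_support:
  fixes g :: "'a::euclidean_space \<Rightarrow> real"
  assumes "g \<in> borel_measurable borel" "\<And>z. \<bar>g z\<bar> \<le> C" "compact S" "\<And>z. z \<notin> S \<Longrightarrow> g z = 0"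
  shows "integrable lborel g"
  using assms emeasure_compact_finite[OF assms(3)]
  by (intro integrableI_bounded_set[where A = S and B = C])
    (auto intro: compact_imp_closed borel_closed)

subsection \<open>One-dimensional meshes and traces\<close>

lemma nodes_less: "nodes a b n s \<Longrightarrow> i < j \<Longrightarrow> j \<le> n \<Longrightarrow> s i < s j"
  unfolding nodes_def by (metis atLeastAtMost_iff le0 le_trans less_imp_le_nat strict_mono_onD)

lemma nodes_le: "nodes a b n s \<Longrightarrow> i \<le> j \<Longrightarrow> j \<le> n \<Longrightarrow> s i \<le> s j"
  using nodes_less[of a b n s i j] by (cases "i = j") auto

lemma nodes_bounds: "nodes a b n s \<Longrightarrow> i \<le> n \<Longrightarrow> a \<le> s i \<and> s i \<le> b"
  using nodes_le[of a b n s 0 i] nodes_le[of a b n s i n] by (auto simp: nodes_def)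

lemma nodes_cell_subset: "nodes a b n s \<Longrightarrow> i < n \<Longrightarrow> {s i..s (Suc i)} \<subseteq> {a..b}"
  using nodes_bounds[of a b n s i] nodes_bounds[of a b n s "Suc i"] by auto

lemma nodes_locate:
  assumes "nodes a b n s" "a < b" "a \<le> y" "y \<le> b"
  obtains i where "i < n" "s i \<le> y" "y \<le> s (Suc i)"
proof -
  have "\<exists>i<n. s i \<le> y \<and> y \<le> s (Suc i)"
  proof (rule ccontr)
    assume *: "\<not> (\<exists>i<n. s i \<le> y \<and> y \<le> s (Suc i))"
    have "0 < n" using assms by (metis gr0I nodes_def order.strict_iff_order)
    \<comment> \<open>If no cell contains \<open>y\<close>, then \<open>s i \<le> y\<close> forces
      \<open>s (Suc i) < y\<close>. So \<open>y\<close> passes every node; but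
      \<open>s (n - 1) \<le> y \<le> b = s n\<close> puts it into the last cell.\<close>
    have "i \<le> n \<Longrightarrow> s i \<le> y" for i
    proof (induction i)
      case 0 then show ?case using assms by (simp add: nodes_def)
    next
      case (Suc i) then show ?case using * by (meson Suc_le_eq less_imp_le not_le)
    qed
    from this[of "n - 1"] \<open>0 < n\<close> * assms(1,4) show False
      by (auto simp: nodes_def dest!: spec[of _ "n - 1"])
  qed
  then show ?thesis using that by blast
qed

lemma nodes_unique:
  assumes "nodes a b n s" "i < n" "j < n" "s i < y" "y < s (Suc i)" "s j < y" "y < s (Suc j)"
  shows "i = j"
proof (rule ccontr)
  assume "i \<noteq> j"
  then consider "Suc i \<le> j" | "Suc j \<le> i" by linarith
  then show False
    using nodes_le[OF assms(1), of "Suc i" j] nodes_le[OF assms(1), of "Suc j" i] assms by cases auto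
qed

section \<open>One-sided limits and periodic traces of piecewise continuous functions\<close>

lemma Lim_at_left_eq:
  fixes F h :: "real \<Rightarrow> real"
  assumes "l < r" "continuous_on {l..r} h" "\<And>y. l < y \<Longrightarrow> y < r \<Longrightarrow> F y = h y"
  shows "Lim (at_left r) F = h r"
proof (rule tendsto_Lim)
  have "(h \<longlongrightarrow> h r) (at r within {l..r})"
    using assms by (auto simp: continuous_on_def)
  then have "(h \<longlongrightarrow> h r) (at_left r)"
    using assms(1) by (simp add: at_within_Icc_at_left)
  moreover have "\<forall>\<^sub>F y in at_left r. h y = F y"
    using eventually_at_left_real[OF \<open>l < r\<close>] by eventually_elim (use assms(3) in auto)
  ultimately show "(F \<longlongrightarrow> h r) (at_left r)"
    by (rule Lim_transform_eventually)
qed simp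

lemma Lim_at_right_eq:
  fixes F h :: "real \<Rightarrow> real"
  assumes "l < r" "continuous_on {l..r} h" "\<And>y. l < y \<Longrightarrow> y < r \<Longrightarrow> F y = h y"
  shows "Lim (at_right l) F = h l"
proof (rule tendsto_Lim)
  have "(h \<longlongrightarrow> h l) (at l within {l..r})"
    using assms by (auto simp: continuous_on_def)
  then have "(h \<longlongrightarrow> h l) (at_right l)"
    using assms(1) by (simp add: at_within_Icc_at_right)
  moreover have "\<forall>\<^sub>F y in at_right l. h y = F y"
    using eventually_at_right_real[OF \<open>l < r\<close>] by eventually_elim (use assms(3) in auto)
  ultimately show "(F \<longlongrightarrow> h l) (at_right l)"
    by (rule Lim_transform_eventually)
qed simp

text \<open>Each branch \<open>h i\<close> is continuous up to both ends of its cell, so its end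
  values are the one-sided limits of \<open>F\<close>, whatever \<open>F\<close> does at the
  nodes.\<close>

context
  fixes a b :: real and n :: nat and s :: "nat \<Rightarrow> real" and F :: "real \<Rightarrow> real"
    and h :: "nat \<Rightarrow> real \<Rightarrow> real"
  assumes nodes: "nodes a b n s"
    and cont: "\<And>i. i < n \<Longrightarrow> continuous_on {s i..s (Suc i)} (h i)"
    and eq: "\<And>i y. i < n \<Longrightarrow> s i < y \<Longrightarrow> y < s (Suc i) \<Longrightarrow> F y = h i y"
begin

lemma piecewise_Lim_left: "i < n \<Longrightarrow> Lim (at_left (s (Suc i))) F = h i (s (Suc i))"
  using nodes_less[OF nodes, of i "Suc i"] cont eq by (intro Lim_at_left_eq[of "s i"]) auto

lemma piecewise_Lim_right: "i < n \<Longrightarrow> Lim (at_right (s i)) F = h i (s i)"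
  using nodes_less[OF nodes, of i "Suc i"] cont eq by (intro Lim_at_right_eq[of _ "s (Suc i)"]) auto

lemma piecewise_trace_below_upper:
  assumes "i < n"
  shows "trace_below a b F (s (Suc i)) = h i (s (Suc i))"
proof -
  have "s (Suc i) \<noteq> a"
    using nodes nodes_less[OF nodes, of 0 "Suc i"] assms by (auto simp: nodes_def)
  then show ?thesis using assms by (simp add: trace_below_def piecewise_Lim_left)
qed

lemma piecewise_trace_above_lower:
  assumes "i < n"
  shows "trace_above a b F (s i) = h i (s i)"
proof -
  have "s i \<noteq> b"
    using nodes nodes_less[OF nodes, of i n] assms by (auto simp: nodes_def)
  then show ?thesis using assms by (simp add: trace_above_def piecewise_Lim_right)
qed

text \<open>At the last face \<open>trace_above\<close> replaces \<open>b\<close> by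
  \<open>a\<close>, the lower node of cell 0; this is where \<open>nxt\<close> wraps around. For the
  lower trace below, \<open>prv\<close> wraps from cell 0 to cell \<open>n - 1\<close> in the same
  way.\<close>

lemma piecewise_trace_above_upper:
  assumes "i < n"
  shows "trace_above a b F (s (Suc i)) = h (nxt n i) (s (nxt n i))"
proof (cases "Suc i = n")
  case True
  then have "s (Suc i) = b" "a = s 0" using nodes by (auto simp: nodes_def)
  with True show ?thesis using assms
    by (simp add: trace_above_def nxt_def piecewise_Lim_right)
next
  case False
  then show ?thesis using assms piecewise_trace_above_lower[of "Suc i"] by (simp add: nxt_def)
qed

lemma piecewise_trace_below_lower:
  assumes "i < n"
  shows "trace_below a b F (s i) = h (prv n i) (s (Suc (prv n i)))"
proof (cases "i = 0")
  case True
  then have "s i = a" "b = s (Suc (n - 1))" using nodes assms by (auto simp: nodes_def)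
  with True show ?thesis using assms piecewise_Lim_left[of "n - 1"]
    by (simp add: trace_below_def prv_def)
next
  case False
  then show ?thesis using assms piecewise_trace_below_upper[of "i - 1"] by (simp add: prv_def)
qed

end

subsection \<open>Piecewise polynomials and the band\<close>

lemma poly3_eq: "poly3 d c (x, p, \<mu>) =
    (\<Sum>\<alpha>\<in>{(a, b, e). a + b + e \<le> d}. c \<alpha> * x ^ fst \<alpha> * p ^ fst (snd \<alpha>) * \<mu> ^ snd (snd \<alpha>))"
  by (simp add: poly3_def case_prod_unfold)

text \<open>The termwise partial derivative of \<open>poly3\<close> in x. For exponent 0 the
  truncated difference \<open>fst \<alpha> - 1\<close> is harmless, because the factor
  \<open>of_nat (fst \<alpha>)\<close> is zero; likewise for the other two coordinates.\<close>

definition poly3_x :: "nat \<Rightarrow> (nat \<times> nat \<times> nat \<Rightarrow> real) \<Rightarrow> real \<times> real \<times> real \<Rightarrow> real" where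
  "poly3_x d c z = (\<Sum>\<alpha>\<in>{(a, b, e). a + b + e \<le> d}. c \<alpha> * (of_nat (fst \<alpha>) * fst z ^ (fst \<alpha> - 1))
     * fst (snd z) ^ fst (snd \<alpha>) * snd (snd z) ^ snd (snd \<alpha>))"

definition poly3_p :: "nat \<Rightarrow> (nat \<times> nat \<times> nat \<Rightarrow> real) \<Rightarrow> real \<times> real \<times> real \<Rightarrow> real" where
  "poly3_p d c z = (\<Sum>\<alpha>\<in>{(a, b, e). a + b + e \<le> d}. c \<alpha> * fst z ^ fst \<alpha>
     * (of_nat (fst (snd \<alpha>)) * fst (snd z) ^ (fst (snd \<alpha>) - 1)) * snd (snd z) ^ snd (snd \<alpha>))"

definition poly3_m :: "nat \<Rightarrow> (nat \<times> nat \<times> nat \<Rightarrow> real) \<Rightarrow> real \<times> real \<times> real \<Rightarrow> real" where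
  "poly3_m d c z = (\<Sum>\<alpha>\<in>{(a, b, e). a + b + e \<le> d}. c \<alpha> * fst z ^ fst \<alpha>
     * fst (snd z) ^ fst (snd \<alpha>) * (of_nat (snd (snd \<alpha>)) * snd (snd z) ^ (snd (snd \<alpha>) - 1)))"

lemma has_real_derivative_poly3:
  "((\<lambda>y. poly3 d c (y, p, \<mu>)) has_real_derivative poly3_x d c (x, p, \<mu>)) (at x)"
  "((\<lambda>y. poly3 d c (x, y, \<mu>)) has_real_derivative poly3_p d c (x, p, \<mu>)) (at p)"
  "((\<lambda>y. poly3 d c (x, p, y)) has_real_derivative poly3_m d c (x, p, \<mu>)) (at \<mu>)"
  unfolding poly3_eq poly3_x_def poly3_p_def poly3_m_def
  by (auto intro!: DERIV_sum derivative_eq_intros simp: mult_ac)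

lemma continuous_on_poly3_aux:
  "continuous_on UNIV (poly3 d c)" "continuous_on UNIV (poly3_x d c)"
  "continuous_on UNIV (poly3_p d c)" "continuous_on UNIV (poly3_m d c)"
  unfolding poly3_def poly3_x_def poly3_p_def poly3_m_def case_prod_unfold
  by (intro continuous_intros)+

lemma continuous_on_poly3 [continuous_intros]:
  assumes "continuous_on S g"
  shows "continuous_on S (\<lambda>z. poly3 d c (g z))" "continuous_on S (\<lambda>z. poly3_x d c (g z))"
    "continuous_on S (\<lambda>z. poly3_p d c (g z))" "continuous_on S (\<lambda>z. poly3_m d c (g z))"
  by (rule continuous_on_compose2[OF continuous_on_poly3_aux(1) assms]
      continuous_on_compose2[OF continuous_on_poly3_aux(2) assms]
      continuous_on_compose2[OF continuous_on_poly3_aux(3) assms]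
      continuous_on_compose2[OF continuous_on_poly3_aux(4) assms]; simp)+

lemma poly3_has_real_derivative_coeffs:
  assumes "\<And>\<alpha>. ((\<lambda>s. c s \<alpha>) has_real_derivative c' \<alpha>) (at t within S)"
  shows "((\<lambda>s. poly3 d (c s) z) has_real_derivative poly3 d c' z) (at t within S)"
proof -
  obtain x p \<mu> where [simp]: "z = (x, p, \<mu>)" by (cases z) auto
  show ?thesis
    unfolding \<open>z = (x, p, \<mu>)\<close> poly3_eq by (intro DERIV_sum DERIV_cmult_right assms)
qed

lemma bp_model_nodes:
  assumes "bp_model D"
  shows "nodes 0 (len D) (nx D) (xs D)" "nodes 0 (pmax D) (np D) (ps D)" "nodes (-1) 1 (nm D) (ms D)"
  using assms by (auto simp: bp_model_def)

lemma bp_model_band: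
  assumes "bp_model D" "p \<in> {0..pmax D}"
  shows "(band D has_real_derivative deriv (band D) p) (at p)" "0 < deriv (band D) p"
    and "isCont (deriv (band D)) p"
proof -
  have *: "(deriv ^^ n) (band D) field_differentiable at p" for n
    using assms by (auto simp: bp_model_def)
  from *[of 0] show "(band D has_real_derivative deriv (band D) p) (at p)"
    by (simp add: DERIV_deriv_iff_field_differentiable)
  from *[of 1] show "isCont (deriv (band D)) p"
    by (simp add: field_differentiable_imp_continuous_at)
  from assms show "0 < deriv (band D) p" by (auto simp: bp_model_def)
qed

lemma continuous_on_band:
  assumes "bp_model D"
  shows "continuous_on {0..pmax D} (band D)" "continuous_on {0..pmax D} (deriv (band D))"
  using bp_model_band[OF assms] DERIV_isCont by (blast intro: continuous_at_imp_continuous_on)+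

subsection \<open>The collision operator\<close>

text \<open>
  Borel versions of the band data, extended by zero; the density of states \<open>dos\<close> itself carries
  unspecified values at the two ends of the energy range.
\<close>

definition bandB :: "bp_data \<Rightarrow> real \<Rightarrow> real" where
  "bandB D p = indicator {0..pmax D} p * band D p"

definition invB :: "bp_data \<Rightarrow> real \<Rightarrow> real" where
  "invB D e = indicator {0..band D (pmax D)} e * inv_band D e"

definition dosB :: "bp_data \<Rightarrow> real \<Rightarrow> real" where
  "dosB D e = indicator {0..band D (pmax D)} e * ((inv_band D e)\<^sup>2 * inverse (deriv (band D) (inv_band D e)))"

text \<open>The momenta from which a phonon leads to a node of the mesh or to an end of the band.\<close>

definition resonant :: "bp_data \<Rightarrow> real set" where
  "resonant D = {p \<in> {0..pmax D}. \<exists>j\<in>{-1..1::int}. \<exists>k\<in>{..np D}.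
     band D p + of_int j * phonon_energy D = band D (ps D k)}"

text \<open>The gain is a Lebesgue integral of a jointly Borel integrand once \<open>F\<close> is
  Borel, so the result stays Borel when \<open>F\<close> also depends on x as a parameter, as Fubini
  demands. The factor \<open>dosB\<close> does not depend on \<mu>' and stands outside the
  integral.\<close>

definition collisionB :: "bp_data \<Rightarrow> (real \<times> real \<Rightarrow> real) \<Rightarrow> real \<times> real \<Rightarrow> real" where
  "collisionB D F = (\<lambda>(p, \<mu>).
     2 * pi * (\<Sum>j\<in>{-1..1::int}. rate D j *
        (LINT \<mu>'|lborel. indicator {-1..1} \<mu>' * F (invB D (bandB D p + of_int j * phonon_energy D), \<mu>'))
          * dosB D (bandB D p + of_int j * phonon_energy D))
     - 4 * pi * F (p, \<mu>) * (\<Sum>j\<in>{-1..1::int}. rate D j *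
        dosB D (bandB D p - of_int j * phonon_energy D)))"

context
  fixes D :: bp_data
  assumes model: "bp_model D"
begin

abbreviation (input) "emax \<equiv> band D (pmax D)"

section \<open>The inverse band and the density of states\<close>

lemma pmax_pos: "0 < pmax D" and band_0: "band D 0 = 0"
  using model by (auto simp: bp_model_def)

lemma band_strict_mono:
  assumes "0 \<le> a" "a < b" "b \<le> pmax D"
  shows "band D a < band D b"
proof (rule DERIV_pos_imp_increasing[OF \<open>a < b\<close>])
  fix x assume "a \<le> x" "x \<le> b"
  then have "x \<in> {0..pmax D}" using assms by simp
  then show "\<exists>y. (band D has_real_derivative y) (at x) \<and> 0 < y"
    using bp_model_band(1,2)[OF model] by (intro exI conjI)
qed

lemma band_mono:
  assumes "0 \<le> a" "a \<le> b" "b \<le> pmax D"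
  shows "band D a \<le> band D b"
  using band_strict_mono[of a b] assms by (cases "a = b") auto

lemma inj_on_band: "inj_on (band D) {0..pmax D}"
proof (rule inj_onI)
  fix a b assume "a \<in> {0..pmax D}" "b \<in> {0..pmax D}" "band D a = band D b"
  then show "a = b"
    using band_strict_mono[of a b] band_strict_mono[of b a] by (cases a b rule: linorder_cases) auto
qed

lemma band_image: "band D ` {0..pmax D} = {0..emax}"
proof
  show "band D ` {0..pmax D} \<subseteq> {0..emax}"
    using band_mono[of 0] band_mono[of _ "pmax D"] pmax_pos band_0 by auto
  show "{0..emax} \<subseteq> band D ` {0..pmax D}"
  proof
    fix e assume "e \<in> {0..emax}"
    then obtain p where "0 \<le> p" "p \<le> pmax D" "band D p = e"
      using IVT'[of "band D" 0 e "pmax D"] continuous_on_band(1)[OF model] band_0 pmax_pos by auto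
    then show "e \<in> band D ` {0..pmax D}" by auto
  qed
qed

lemma inv_band_band: "p \<in> {0..pmax D} \<Longrightarrow> inv_band D (band D p) = p"
  unfolding inv_band_def by (rule the_inv_into_f_f[OF inj_on_band])

lemma band_inv_band: "e \<in> {0..emax} \<Longrightarrow> band D (inv_band D e) = e"
  unfolding inv_band_def by (rule f_the_inv_into_f[OF inj_on_band]) (simp add: band_image)

lemma inv_band_range: "e \<in> {0..emax} \<Longrightarrow> inv_band D e \<in> {0..pmax D}"
  unfolding inv_band_def by (rule the_inv_into_into[OF inj_on_band]) (auto simp: band_image)

lemma continuous_on_inv_band: "continuous_on {0..emax} (inv_band D)"
  unfolding band_image[symmetric]
  by (rule continuous_on_inv) (use continuous_on_band(1)[OF model] inv_band_band in auto)

text \<open>Confined to the open energy range: \<open>deriv\<close> is two-sided, and beyond the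
  ends \<open>inv_band\<close> takes the unspecified values of \<open>the_inv_into\<close>.\<close>

lemma deriv_inv_band:
  assumes "0 < e" "e < emax"
  shows "deriv (inv_band D) e = inverse (deriv (band D) (inv_band D e))"
proof -
  have e: "e \<in> {0..emax}" using assms by auto
  note p = inv_band_range[OF e]
  have "(inv_band D has_real_derivative inverse (deriv (band D) (inv_band D e))) (at e)"
  proof (rule DERIV_inverse_function[where a = 0 and b = emax and f = "band D"])
    show "(band D has_real_derivative deriv (band D) (inv_band D e)) (at (inv_band D e))"
      by (rule bp_model_band(1)[OF model p])
    show "deriv (band D) (inv_band D e) \<noteq> 0"
      using bp_model_band(2)[OF model p] by simp
    show "band D (inv_band D y) = y" if "0 < y" "y < emax" for y
      using that by (intro band_inv_band) auto
    show "isCont (inv_band D) e"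
      using continuous_on_interior[OF continuous_on_inv_band] assms by auto
  qed (use assms in auto)
  then show ?thesis by (rule DERIV_imp_deriv)
qed

lemma dos_eq_dosB: "e \<noteq> 0 \<Longrightarrow> e \<noteq> emax \<Longrightarrow> dos D e = dosB D e"
  by (auto simp: dos_def dosB_def cutoff_def deriv_inv_band)

lemma dosB_nonneg: "0 \<le> dosB D e"
  using bp_model_band(2)[OF model inv_band_range[of e]]
  by (auto simp: dosB_def indicator_def less_imp_le)

lemma measurable_bandB [measurable]: "bandB D \<in> borel_measurable borel"
  unfolding bandB_def using continuous_on_band(1)[OF model] by (rule measurable_indicator_mult)

lemma measurable_invB [measurable]: "invB D \<in> borel_measurable borel"
  unfolding invB_def using continuous_on_inv_band by (rule measurable_indicator_mult)

lemma continuous_on_dos: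
  "continuous_on {0..emax} (\<lambda>e. (inv_band D e)\<^sup>2 * inverse (deriv (band D) (inv_band D e)))"
proof (intro continuous_intros continuous_on_inv_band)
  show "continuous_on {0..emax} (\<lambda>e. deriv (band D) (inv_band D e))"
    by (rule continuous_on_compose2[OF continuous_on_band(2)[OF model] continuous_on_inv_band])
      (use inv_band_range in auto)
  show "\<forall>e\<in>{0..emax}. deriv (band D) (inv_band D e) \<noteq> 0"
    using bp_model_band(2)[OF model inv_band_range] by force
qed

lemma measurable_dosB [measurable]: "dosB D \<in> borel_measurable borel"
  unfolding dosB_def using continuous_on_dos by (rule measurable_indicator_mult)

lemma dosB_bounded: obtains M where "0 \<le> M" "\<And>e. \<bar>dosB D e\<bar> \<le> M"
proof -
  have "bounded ((\<lambda>e. (inv_band D e)\<^sup>2 * inverse (deriv (band D) (inv_band D e))) ` {0..emax})"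
    by (intro compact_imp_bounded compact_continuous_image continuous_on_dos) simp
  then obtain M where M: "\<forall>e\<in>{0..emax}.
      \<bar>(inv_band D e)\<^sup>2 * inverse (deriv (band D) (inv_band D e))\<bar> \<le> M"
    by (auto simp: bounded_iff)
  have "\<bar>dosB D e\<bar> \<le> \<bar>M\<bar>" for e
    by (cases "e \<in> {0..emax}") (use M in \<open>auto simp: dosB_def intro: order_trans[OF _ abs_ge_self]\<close>)
  then show ?thesis using that[of "\<bar>M\<bar>"] by auto
qed

lemma bandB_bounds: "0 \<le> bandB D p" "bandB D p \<le> emax"
  using band_image band_mono[of 0 "pmax D"] pmax_pos band_0
  by (auto simp: bandB_def indicator_def)

text \<open>The band is injective, so each pair of a shift \<open>j\<close> and a node
  \<open>k\<close> excludes at most one momentum.\<close>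

lemma finite_resonant: "finite (resonant D)"
proof -
  have "resonant D \<subseteq> (\<Union>j\<in>{-1..1::int}. \<Union>k\<in>{..np D}.
      (inv_band D ` {band D (ps D k) - of_int j * phonon_energy D}))"
  proof
    fix p assume "p \<in> resonant D"
    then obtain j k where *: "p \<in> {0..pmax D}" "j \<in> {-1..1::int}" "k \<in> {..np D}"
      "band D p = band D (ps D k) - of_int j * phonon_energy D"
      by (auto simp: resonant_def algebra_simps)
    then have "p = inv_band D (band D (ps D k) - of_int j * phonon_energy D)"
      using inv_band_band[of p] by simp
    with * show "p \<in> (\<Union>j\<in>{-1..1::int}. \<Union>k\<in>{..np D}.
      (inv_band D ` {band D (ps D k) - of_int j * phonon_energy D}))" by blast
  qed
  then show ?thesis by (rule finite_subset) auto
qed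

lemma not_resonant:
  assumes "p \<in> {0..pmax D}" "p \<notin> resonant D" "j \<in> {-1..1::int}" "k \<le> np D"
  shows "band D p + of_int j * phonon_energy D \<noteq> band D (ps D k)"
  using assms by (auto simp: resonant_def)

lemma dos_not_resonant:
  assumes "p \<in> {0..pmax D}" "p \<notin> resonant D" "j \<in> {-1..1::int}"
  shows "dos D (band D p + of_int j * phonon_energy D) = dosB D (band D p + of_int j * phonon_energy D)"
    "dos D (band D p - of_int j * phonon_energy D) = dosB D (band D p - of_int j * phonon_energy D)"
proof -
  have 0: "band D (ps D 0) = 0" "band D (ps D (np D)) = emax"
    using bp_model_nodes(2)[OF model] band_0 by (auto simp: nodes_def)
  show "dos D (band D p + of_int j * phonon_energy D) = dosB D (band D p + of_int j * phonon_energy D)"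
    using not_resonant[OF assms, of 0] not_resonant[OF assms, of "np D"] 0 by (intro dos_eq_dosB) auto
  \<comment> \<open>The loss term shifts the energy downwards; the range of \<open>j\<close> is
    symmetric, so the momenta excluded for upward shifts also cover this case.\<close>
  have "- j \<in> {-1..1::int}" using assms(3) by auto
  from not_resonant[OF assms(1,2) this, of 0] not_resonant[OF assms(1,2) this, of "np D"]
  show "dos D (band D p - of_int j * phonon_energy D) = dosB D (band D p - of_int j * phonon_energy D)"
    using 0 by (intro dos_eq_dosB) auto
qed

text \<open>\<open>F\<close> stands for a Borel version and \<open>G\<close> for the discrete
  solution on a slice. Agreement almost everywhere would not suffice, because the gain term reads
  its argument on the single line p' = \<open>inv_band D e'\<close>. A momentum \<open>p\<close>
  that is not resonant keeps this line off the nodes in p, and then only finitely many \<mu>' on it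
  are exceptional.\<close>

lemma collision_eq_collisionB:
  assumes F: "F \<in> borel_measurable borel" and bound: "\<And>z. \<bar>F z\<bar> \<le> M"
    and p: "p \<in> {0..pmax D}" "p \<notin> resonant D"
    and G: "\<And>p' \<mu>'. \<lbrakk>p' \<in> {0..pmax D}; p' \<notin> ps D ` {..np D}; \<mu>' \<in> {-1..1}; \<mu>' \<notin> ms D ` {..nm D}\<rbrakk>
      \<Longrightarrow> G (p', \<mu>') = F (p', \<mu>')"
    and G': "G (p, \<mu>) = F (p, \<mu>)"
  shows "collision D G (p, \<mu>) = collisionB D F (p, \<mu>)"
proof -
  have gain: "integral {-1..1} (\<lambda>\<mu>'. G (inv_band D e', \<mu>') * dos D e')
      = (LINT \<mu>'|lborel. indicator {-1..1} \<mu>' * F (invB D e', \<mu>')) * dosB D e'"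
    if j: "j \<in> {-1..1::int}" and e': "e' = band D p + of_int j * phonon_energy D" for j e'
  proof (cases "e' \<in> {0..emax}")
    case False
    moreover have "dosB D e' = 0" "dos D e' = 0"
      using False by (auto simp: dosB_def dos_def cutoff_def)
    ultimately show ?thesis by simp
  next
    case True
    have p': "inv_band D e' \<notin> ps D ` {..np D}"
      using band_inv_band[OF True] not_resonant[OF p j] e' by force
    have "integral {-1..1} (\<lambda>\<mu>'. G (inv_band D e', \<mu>') * dos D e')
        = integral {-1..1} (\<lambda>\<mu>'. F (invB D e', \<mu>') * dosB D e')"
    proof (rule integral_spike[of "ms D ` {..nm D}"])
      fix \<mu>' assume "\<mu>' \<in> {-1..1} - ms D ` {..nm D}"
      then show "F (invB D e', \<mu>') * dosB D e' = G (inv_band D e', \<mu>') * dos D e'"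
        using G[of "inv_band D e'" \<mu>'] inv_band_range[OF True] p' True dos_not_resonant(1)[OF p j]
        by (simp add: e' invB_def)
    qed (auto intro: negligible_finite)
    also have "\<dots> = integral {-1..1} (\<lambda>\<mu>'. F (invB D e', \<mu>')) * dosB D e'" by simp
    also have "integral {-1..1} (\<lambda>\<mu>'. F (invB D e', \<mu>')) = (LINT \<mu>'|lborel. indicator {-1..1} \<mu>' * F (invB D e', \<mu>'))"
    proof -
      have "set_integrable lborel {-1..1} (\<lambda>\<mu>'. F (invB D e', \<mu>'))"
        unfolding set_integrable_def using F bound
        by (intro integrableI_bounded_set_indicator[where B = M]) auto
      from set_borel_integral_eq_integral(2)[OF this] show ?thesis
        by (simp add: set_lebesgue_integral_def)
    qed
    finally show ?thesis .
  qed
  have "bandB D p = band D p" using p by (simp add: bandB_def)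
  then have "(\<Sum>j\<in>{-1..1::int}. rate D j * (let e' = band D p + of_int j * phonon_energy D
        in integral {-1..1} (\<lambda>\<mu>'. G (inv_band D e', \<mu>') * dos D e')))
      = (\<Sum>j\<in>{-1..1::int}. rate D j *
        (LINT \<mu>'|lborel. indicator {-1..1} \<mu>' * F (invB D (bandB D p + of_int j * phonon_energy D), \<mu>'))
          * dosB D (bandB D p + of_int j * phonon_energy D))"
    by (intro sum.cong refl) (simp only: Let_def gain[OF _ refl] mult.assoc)
  moreover have "(\<Sum>j\<in>{-1..1::int}. rate D j * dos D (band D p - of_int j * phonon_energy D))
      = (\<Sum>j\<in>{-1..1::int}. rate D j * dosB D (bandB D p - of_int j * phonon_energy D))"
    using \<open>bandB D p = band D p\<close> by (intro sum.cong refl) (simp only: dos_not_resonant(2)[OF p])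
  ultimately show ?thesis
    unfolding collision_def collisionB_def prod.case G' by simp
qed

lemma rate_nonneg: "0 \<le> rate D j"
  using model by (auto simp: rate_def bp_model_def)

lemma collision_entropy_nonpos:
  assumes F: "F \<in> borel_measurable borel" and bound: "\<And>z. \<bar>F z\<bar> \<le> M"
  shows "integral ({0..pmax D} \<times> {-1..1})
    (\<lambda>(p, \<mu>). collision D F (p, \<mu>) * (F (p, \<mu>) * exp (bandB D p)) * p\<^sup>2) \<le> 0"
proof -
  \<comment> \<open>\<open>bandB\<close> in place of \<open>band\<close> makes \<open>G\<close>
    Borel and bounded on the whole plane, as \<open>dissipative\<close> asks; for momenta in the
    band it is F e^\<epsilon>.\<close>
  define G where "G = (\<lambda>(p, \<mu>). F (p, \<mu>) * exp (bandB D p))"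
  have "G \<in> borel_measurable borel"
    unfolding G_def using F by (simp add: case_prod_unfold borel_prod[symmetric])
  moreover have "bounded (range F)" using bound by (auto simp: bounded_iff)
  moreover have "bounded (range G)"
  proof -
    have "\<bar>G z\<bar> \<le> M * exp emax" for z
      unfolding G_def case_prod_unfold abs_mult
      using bound[of z] bandB_bounds(2)[of "fst z"] by (intro mult_mono) auto
    then show ?thesis by (auto simp: bounded_iff)
  qed
  ultimately have diss: "2 * pi * integral ({0..pmax D} \<times> {-1..1})
        (\<lambda>(p, \<mu>). collision D F (p, \<mu>) * G (p, \<mu>) * p\<^sup>2)
     = - (1 / 2) * (2 * pi)\<^sup>2 * (\<Sum>j\<in>{-1..1::int}. rate D j *
        integral ({0..pmax D} \<times> {-1..1} \<times> {-1..1}) (\<lambda>(p, \<mu>, \<mu>').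
          let e' = band D p + of_int j * phonon_energy D; p' = inv_band D e'
          in dos D e' * exp (- e') *
             (F (p', \<mu>') / exp (- e') - F (p, \<mu>) / exp (- band D p)) *
             (G (p', \<mu>') - G (p, \<mu>)) * p\<^sup>2))"
    using model F unfolding bp_model_def dissipative_def by blast
  have "0 \<le> integral ({0..pmax D} \<times> {-1..1} \<times> {-1..1}) (\<lambda>(p, \<mu>, \<mu>').
          let e' = band D p + of_int j * phonon_energy D; p' = inv_band D e'
          in dos D e' * exp (- e') *
             (F (p', \<mu>') / exp (- e') - F (p, \<mu>) / exp (- band D p)) *
             (G (p', \<mu>') - G (p, \<mu>)) * p\<^sup>2)" (is "0 \<le> integral _ ?f")
    if j: "j \<in> {-1..1::int}" for j
  proof (rule integral_nonneg_off_negligible)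
    \<comment> \<open>At a resonance with the upper band edge the factor \<open>dos\<close> contains
      an unspecified derivative, so the sign of the integrand is known only away from these
      momenta.\<close>
    show "negligible {z :: real \<times> real \<times> real. fst z \<in> resonant D}"
      by (rule negligible_coordinate(1)[OF finite_resonant])
    fix z :: "real \<times> real \<times> real"
    assume z: "z \<in> {0..pmax D} \<times> {-1..1} \<times> {-1..1} - {z. fst z \<in> resonant D}"
    obtain p \<mu> \<mu>' where [simp]: "z = (p, \<mu>, \<mu>')" by (cases z) auto
    define e' where "e' = band D p + of_int j * phonon_energy D"
    from z have p: "p \<in> {0..pmax D}" "p \<notin> resonant D" by auto
    have dos: "dos D e' = dosB D e'" unfolding e'_def by (rule dos_not_resonant(1)[OF p j])
    show "0 \<le> ?f z"
    proof (cases "e' \<in> {0..emax}")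
      case False
      then have "dosB D e' = 0" by (auto simp: dosB_def)
      then show ?thesis by (simp add: Let_def dos flip: e'_def)
    next
      case True
      have "G (inv_band D e', \<mu>') = F (inv_band D e', \<mu>') / exp (- e')"
        using inv_band_range[OF True] band_inv_band[OF True] by (simp add: G_def bandB_def exp_minus field_simps)
      moreover have "G (p, \<mu>) = F (p, \<mu>) / exp (- band D p)"
        using p by (simp add: G_def bandB_def exp_minus field_simps)
      moreover have "?f z = dos D e' * exp (- e') * (F (inv_band D e', \<mu>') / exp (- e')
          - F (p, \<mu>) / exp (- band D p)) * (G (inv_band D e', \<mu>') - G (p, \<mu>)) * p\<^sup>2"
        by (simp add: Let_def e'_def)
      ultimately have "?f z = dosB D e' * exp (- e') * (G (inv_band D e', \<mu>') - G (p, \<mu>))\<^sup>2 * p\<^sup>2"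
        by (simp only: dos power2_eq_square mult.assoc)
      then show ?thesis using dosB_nonneg[of e'] by simp
    qed
  qed
  then have "0 \<le> (\<Sum>j\<in>{-1..1::int}. rate D j *
        integral ({0..pmax D} \<times> {-1..1} \<times> {-1..1}) (\<lambda>(p, \<mu>, \<mu>').
          let e' = band D p + of_int j * phonon_energy D; p' = inv_band D e'
          in dos D e' * exp (- e') *
             (F (p', \<mu>') / exp (- e') - F (p, \<mu>) / exp (- band D p)) *
             (G (p', \<mu>') - G (p, \<mu>)) * p\<^sup>2))" (is "0 \<le> ?S")
    by (intro sum_nonneg mult_nonneg_nonneg rate_nonneg)
  then have "- (1 / 2) * (2 * pi)\<^sup>2 * ?S \<le> 0"
    by (simp add: mult_nonneg_nonneg)
  with diss have "2 * pi * integral ({0..pmax D} \<times> {-1..1})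
        (\<lambda>(p, \<mu>). collision D F (p, \<mu>) * G (p, \<mu>) * p\<^sup>2) \<le> 0" by linarith
  then have "integral ({0..pmax D} \<times> {-1..1})
        (\<lambda>(p, \<mu>). collision D F (p, \<mu>) * G (p, \<mu>) * p\<^sup>2) \<le> 0"
    using pi_gt_zero by (simp add: mult_le_0_iff)
  then show ?thesis by (simp add: G_def)
qed

end

subsection \<open>Transport terms on a cell\<close>

lemmas basic_continuous_intros = continuous_on_mult continuous_on_add continuous_on_diff
  continuous_on_minus continuous_on_divide continuous_on_power continuous_on_exp
  continuous_on_const continuous_on_fst continuous_on_snd continuous_on_Pair continuous_on_id
  continuous_on_rabs

text \<open>
  The scheme at a fixed time, with potential \<open>\<phi>\<close>: \<open>u\<close> is \<open>f\<^sub>h\<close>, with coefficients \<open>coef i k m\<close> on the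
  cell \<open>(i, k, m)\<close>.
\<close>

locale bp_snapshot =
  fixes D :: bp_data and d :: nat and \<phi> E :: "real \<Rightarrow> real"
    and u :: "real \<times> real \<times> real \<Rightarrow> real"
    and coef :: "nat \<Rightarrow> nat \<Rightarrow> nat \<Rightarrow> nat \<times> nat \<times> nat \<Rightarrow> real"
  assumes model: "bp_model D"
    and potential: "\<And>x. x \<in> {0..len D} \<Longrightarrow> (\<phi> has_real_derivative - E x) (at x within {0..len D})"
    and cont_E: "continuous_on {0..len D} E"
    and potential_periodic: "\<phi> 0 = \<phi> (len D)"
    and u_eq: "\<And>i k m z. \<lbrakk>i < nx D; k < np D; m < nm D; z \<in> interior (cell D i k m)\<rbrakk>
      \<Longrightarrow> u z = poly3 d (coef i k m) z"
begin

abbreviation "q \<equiv> charge D"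
abbreviation "B \<equiv> band D"
abbreviation "B' \<equiv> deriv (band D)"
abbreviation "P i k m \<equiv> poly3 d (coef i k m)"
abbreviation "Px i k m \<equiv> poly3_x d (coef i k m)"
abbreviation "Pp i k m \<equiv> poly3_p d (coef i k m)"
abbreviation "Pm i k m \<equiv> poly3_m d (coef i k m)"

definition H :: "real \<Rightarrow> real \<Rightarrow> real" where
  "H x p = B p - q * \<phi> x"

lemmas nodes_x = bp_model_nodes(1)[OF model]
  and nodes_p = bp_model_nodes(2)[OF model]
  and nodes_m = bp_model_nodes(3)[OF model]

lemma interior_cell:
  "interior (cell D i k m) = {xs D i<..<xs D (Suc i)} \<times> {ps D k<..<ps D (Suc k)} \<times> {ms D m<..<ms D (Suc m)}"
  by (simp add: cell_def interior_Times)

lemma u_cell: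
  "\<lbrakk>i < nx D; k < np D; m < nm D; xs D i < x; x < xs D (Suc i); ps D k < p; p < ps D (Suc k);
    ms D m < \<mu>; \<mu> < ms D (Suc m)\<rbrakk> \<Longrightarrow> u (x, p, \<mu>) = P i k m (x, p, \<mu>)"
  by (rule u_eq) (auto simp: interior_cell)

lemma mesh_less [simp]:
  "i < nx D \<Longrightarrow> xs D i < xs D (Suc i)" "k < np D \<Longrightarrow> ps D k < ps D (Suc k)"
  "m < nm D \<Longrightarrow> ms D m < ms D (Suc m)"
  using nodes_less[OF nodes_x] nodes_less[OF nodes_p] nodes_less[OF nodes_m] by auto

lemma mesh_bounds:
  "i \<le> nx D \<Longrightarrow> 0 \<le> xs D i" "i \<le> nx D \<Longrightarrow> xs D i \<le> len D"
  "k \<le> np D \<Longrightarrow> 0 \<le> ps D k" "k \<le> np D \<Longrightarrow> ps D k \<le> pmax D"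
  "m \<le> nm D \<Longrightarrow> - 1 \<le> ms D m" "m \<le> nm D \<Longrightarrow> ms D m \<le> 1"
  using nodes_bounds[OF nodes_x] nodes_bounds[OF nodes_p] nodes_bounds[OF nodes_m] by auto

lemma mesh_subset:
  "i < nx D \<Longrightarrow> {xs D i..xs D (Suc i)} \<subseteq> {0..len D}"
  "k < np D \<Longrightarrow> {ps D k..ps D (Suc k)} \<subseteq> {0..pmax D}"
  "m < nm D \<Longrightarrow> {ms D m..ms D (Suc m)} \<subseteq> {-1..1}"
  using nodes_cell_subset[OF nodes_x] nodes_cell_subset[OF nodes_p] nodes_cell_subset[OF nodes_m] by auto

lemma mesh_end: "xs D 0 = 0" "ps D 0 = 0" "ms D 0 = -1"
  "xs D (nx D) = len D" "ps D (np D) = pmax D" "ms D (nm D) = 1"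
  using nodes_x nodes_p nodes_m by (auto simp: nodes_def)

lemma cont_potential: "continuous_on {0..len D} \<phi>"
  by (rule DERIV_continuous_on) (rule potential)

lemma continuous_on_coefs:
  "continuous_on S g \<Longrightarrow> g ` S \<subseteq> {0..len D} \<Longrightarrow> continuous_on S (\<lambda>z. \<phi> (g z))"
  "continuous_on S g \<Longrightarrow> g ` S \<subseteq> {0..len D} \<Longrightarrow> continuous_on S (\<lambda>z. E (g z))"
  "continuous_on S g \<Longrightarrow> g ` S \<subseteq> {0..pmax D} \<Longrightarrow> continuous_on S (\<lambda>z. B (g z))"
  "continuous_on S g \<Longrightarrow> g ` S \<subseteq> {0..pmax D} \<Longrightarrow> continuous_on S (\<lambda>z. B' (g z))"
  by (rule continuous_on_compose2[OF cont_potential] continuous_on_compose2[OF cont_E]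
      continuous_on_compose2[OF continuous_on_band(1)[OF model]]
      continuous_on_compose2[OF continuous_on_band(2)[OF model]]; assumption)+

lemma has_derivative_H:
  "0 \<le> x \<Longrightarrow> x \<le> len D \<Longrightarrow> ((\<lambda>y. H y p) has_real_derivative q * E x) (at x within {0..len D})"
  "0 \<le> p \<Longrightarrow> p \<le> pmax D \<Longrightarrow> ((\<lambda>r. H x r) has_real_derivative B' p) (at p)"
  unfolding H_def
  by (auto intro!: derivative_eq_intros potential bp_model_band(1)[OF model] simp: mult_ac)

lemma has_derivative_H_interior:
  assumes "0 < x" "x < len D"
  shows "((\<lambda>y. H y p) has_real_derivative q * E x) (at x)"
  using has_derivative_H(1)[OF less_imp_le[OF assms(1)] less_imp_le[OF assms(2)], of p]
  unfolding at_within_Icc_at[OF assms] .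

text \<open>The product that \<open>dg_equation\<close> differentiates and takes traces of when the
  solution itself is the test function.\<close>

definition w :: "real \<Rightarrow> real \<Rightarrow> real \<Rightarrow> real" where
  "w x p \<mu> = u (x, p, \<mu>) * exp (H x p)"

text \<open>The density f_h^2 e^H of one cell, built from the cell polynomial and therefore
  meaningful up to the faces, where \<open>u\<close> is arbitrary.\<close>

definition W :: "nat \<Rightarrow> nat \<Rightarrow> nat \<Rightarrow> real \<Rightarrow> real \<Rightarrow> real \<Rightarrow> real" where
  "W i k m x p \<mu> = (P i k m (x, p, \<mu>))\<^sup>2 * exp (H x p)"

abbreviation (input) "CX i \<equiv> {xs D i..xs D (Suc i)}"
abbreviation (input) "CP k \<equiv> {ps D k..ps D (Suc k)}"
abbreviation (input) "CM m \<equiv> {ms D m..ms D (Suc m)}"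

context
  fixes i k m :: nat
  assumes cell: "i < nx D" "k < np D" "m < nm D"
begin

lemma deriv_w:
  assumes "xs D i < x" "x < xs D (Suc i)" "ps D k < p" "p < ps D (Suc k)"
    "ms D m < \<mu>" "\<mu> < ms D (Suc m)"
  shows "deriv (\<lambda>y. w y p \<mu>) x = (Px i k m (x, p, \<mu>) + q * E x * P i k m (x, p, \<mu>)) * exp (H x p)"
    and "deriv (\<lambda>r. w x r \<mu>) p = (Pp i k m (x, p, \<mu>) + B' p * P i k m (x, p, \<mu>)) * exp (H x p)"
    and "deriv (\<lambda>n. w x p n) \<mu> = Pm i k m (x, p, \<mu>) * exp (H x p)"
proof -
  have x: "0 < x" "x < len D" and p: "0 < p" "p < pmax D"
    using assms mesh_bounds(1)[OF less_imp_le[OF cell(1)]] mesh_bounds(2)[OF Suc_leI[OF cell(1)]]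
      mesh_bounds(3)[OF less_imp_le[OF cell(2)]] mesh_bounds(4)[OF Suc_leI[OF cell(2)]]
    by linarith+
  have "\<forall>\<^sub>F y in nhds x. y \<in> {xs D i<..<xs D (Suc i)}"
    using assms by (intro eventually_nhds_in_open) auto
  then have "\<forall>\<^sub>F y in nhds x. w y p \<mu> = P i k m (y, p, \<mu>) * exp (H y p)"
    by eventually_elim (use assms cell in \<open>auto simp: w_def u_cell\<close>)
  moreover have "((\<lambda>y. P i k m (y, p, \<mu>) * exp (H y p)) has_real_derivative
      (Px i k m (x, p, \<mu>) + q * E x * P i k m (x, p, \<mu>)) * exp (H x p)) (at x)"
    using x by (auto intro!: derivative_eq_intros has_real_derivative_poly3 has_derivative_H_interior
        simp: algebra_simps)
  ultimately show "deriv (\<lambda>y. w y p \<mu>) x = (Px i k m (x, p, \<mu>) + q * E x * P i k m (x, p, \<mu>)) * exp (H x p)"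
    by (subst deriv_cong_ev) (auto intro: DERIV_imp_deriv)
  have "\<forall>\<^sub>F r in nhds p. r \<in> {ps D k<..<ps D (Suc k)}"
    using assms by (intro eventually_nhds_in_open) auto
  then have "\<forall>\<^sub>F r in nhds p. w x r \<mu> = P i k m (x, r, \<mu>) * exp (H x r)"
    by eventually_elim (use assms cell in \<open>auto simp: w_def u_cell\<close>)
  moreover have "((\<lambda>r. P i k m (x, r, \<mu>) * exp (H x r)) has_real_derivative
      (Pp i k m (x, p, \<mu>) + B' p * P i k m (x, p, \<mu>)) * exp (H x p)) (at p)"
    using p by (auto intro!: derivative_eq_intros has_real_derivative_poly3 has_derivative_H
        simp: algebra_simps)
  ultimately show "deriv (\<lambda>r. w x r \<mu>) p = (Pp i k m (x, p, \<mu>) + B' p * P i k m (x, p, \<mu>)) * exp (H x p)"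
    by (subst deriv_cong_ev) (auto intro: DERIV_imp_deriv)
  have "\<forall>\<^sub>F n in nhds \<mu>. n \<in> {ms D m<..<ms D (Suc m)}"
    using assms by (intro eventually_nhds_in_open) auto
  then have "\<forall>\<^sub>F n in nhds \<mu>. w x p n = P i k m (x, p, n) * exp (H x p)"
    by eventually_elim (use assms cell in \<open>auto simp: w_def u_cell\<close>)
  moreover have "((\<lambda>n. P i k m (x, p, n) * exp (H x p)) has_real_derivative
      Pm i k m (x, p, \<mu>) * exp (H x p)) (at \<mu>)"
    by (auto intro!: derivative_eq_intros has_real_derivative_poly3)
  ultimately show "deriv (\<lambda>n. w x p n) \<mu> = Pm i k m (x, p, \<mu>) * exp (H x p)"
    by (subst deriv_cong_ev) (auto intro: DERIV_imp_deriv)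
qed

lemma continuous_on_cell:
  "continuous_on (CX i \<times> CP k \<times> CM m) (\<lambda>z. \<phi> (fst z))"
  "continuous_on (CX i \<times> CP k \<times> CM m) (\<lambda>z. E (fst z))"
  "continuous_on (CX i \<times> CP k \<times> CM m) (\<lambda>z. B (fst (snd z)))"
  "continuous_on (CX i \<times> CP k \<times> CM m) (\<lambda>z. B' (fst (snd z)))"
  using mesh_subset(1)[OF cell(1)] mesh_subset(2)[OF cell(2)]
  by (auto intro!: continuous_on_coefs continuous_on_fst continuous_on_snd)

text \<open>The right-hand side is minus the flux of f_h^2 e^H / 2 through the six faces of the
  cell. The identity holds for the sum of the three directions only.\<close>

lemma volume_terms:
  "- integral (cell D i k m) (\<lambda>(x, p, \<mu>). B' p * u (x, p, \<mu>) * \<mu> * deriv (\<lambda>y. w y p \<mu>) x * p\<^sup>2)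
   - integral (cell D i k m) (\<lambda>(x, p, \<mu>). p\<^sup>2 * (- q * E x) * u (x, p, \<mu>) * \<mu> * deriv (\<lambda>r. w x r \<mu>) p)
   - integral (cell D i k m) (\<lambda>(x, p, \<mu>). (1 - \<mu>\<^sup>2) * u (x, p, \<mu>) * (- q * E x) * deriv (\<lambda>n. w x p n) \<mu> * p)
   = - integral (CP k \<times> CM m) (\<lambda>(p, \<mu>). \<mu> / 2 * (B' p * p\<^sup>2 * W i k m (xs D (Suc i)) p \<mu> - B' p * p\<^sup>2 * W i k m (xs D i) p \<mu>))
     - integral (CX i \<times> CM m) (\<lambda>(x, \<mu>). - q * E x * \<mu> / 2 * ((ps D (Suc k))\<^sup>2 * W i k m x (ps D (Suc k)) \<mu> - (ps D k)\<^sup>2 * W i k m x (ps D k) \<mu>))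
     - integral (CX i \<times> CP k) (\<lambda>(x, p). - q * E x / 2 * ((1 - (ms D (Suc m))\<^sup>2) * p * W i k m x p (ms D (Suc m)) - (1 - (ms D m)\<^sup>2) * p * W i k m x p (ms D m)))"
proof -
  let ?C = "CX i \<times> CP k \<times> CM m"
  \<comment> \<open>\<open>A1\<close>, \<open>A2\<close>, \<open>A3\<close> are the components of
    half the transport flux of f_h^2 e^H, with the weight p^2 included; the primed functions are
    their derivatives in x, p and \<mu>, and \<open>T1\<close>, \<open>T2\<close>, \<open>T3\<close>
    the integrands of the scheme on the open cell.\<close>
  define A1 where "A1 = (\<lambda>(x, p, \<mu>). \<mu> / 2 * (B' p * p\<^sup>2 * W i k m x p \<mu>))"
  define A2 where "A2 = (\<lambda>(x, p, \<mu>). - q * E x * \<mu> / 2 * (p\<^sup>2 * W i k m x p \<mu>))"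
  define A3 where "A3 = (\<lambda>(x, p, \<mu>). - q * E x / 2 * ((1 - \<mu>\<^sup>2) * p * W i k m x p \<mu>))"
  define A1' where "A1' = (\<lambda>(x, p, \<mu>). \<mu> / 2 * (B' p * p\<^sup>2 *
      ((2 * P i k m (x, p, \<mu>) * Px i k m (x, p, \<mu>) + (P i k m (x, p, \<mu>))\<^sup>2 * (q * E x)) * exp (H x p))))"
  define A2' where "A2' = (\<lambda>(x, p, \<mu>). - q * E x * \<mu> / 2 * (2 * p * W i k m x p \<mu> + p\<^sup>2 *
      ((2 * P i k m (x, p, \<mu>) * Pp i k m (x, p, \<mu>) + (P i k m (x, p, \<mu>))\<^sup>2 * B' p) * exp (H x p))))"
  define A3' where "A3' = (\<lambda>(x, p, \<mu>). - q * E x / 2 * p * (- 2 * \<mu> * W i k m x p \<mu> + (1 - \<mu>\<^sup>2) *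
      (2 * P i k m (x, p, \<mu>) * Pm i k m (x, p, \<mu>) * exp (H x p))))"
  define T1 where "T1 = (\<lambda>(x, p, \<mu>). B' p * P i k m (x, p, \<mu>) * \<mu> * ((Px i k m (x, p, \<mu>) + q * E x * P i k m (x, p, \<mu>)) * exp (H x p)) * p\<^sup>2)"
  define T2 where "T2 = (\<lambda>(x, p, \<mu>). p\<^sup>2 * (- q * E x) * P i k m (x, p, \<mu>) * \<mu> * ((Pp i k m (x, p, \<mu>) + B' p * P i k m (x, p, \<mu>)) * exp (H x p)))"
  define T3 where "T3 = (\<lambda>(x, p, \<mu>). (1 - \<mu>\<^sup>2) * P i k m (x, p, \<mu>) * (- q * E x) * (Pm i k m (x, p, \<mu>) * exp (H x p)) * p)"
  note defs = A1_def A2_def A3_def A1'_def A2'_def A3'_def T1_def T2_def T3_def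
  have cont: "continuous_on ?C A1" "continuous_on ?C A2" "continuous_on ?C A3"
    "continuous_on ?C A1'" "continuous_on ?C A2'" "continuous_on ?C A3'"
    "continuous_on ?C T1" "continuous_on ?C T2" "continuous_on ?C T3"
    unfolding defs case_prod_unfold W_def H_def
    by (intro basic_continuous_intros continuous_on_poly3 continuous_on_cell; simp)+
  have T: "integral (cell D i k m) (\<lambda>(x, p, \<mu>). B' p * u (x, p, \<mu>) * \<mu> * deriv (\<lambda>y. w y p \<mu>) x * p\<^sup>2) = integral ?C T1"
    "integral (cell D i k m) (\<lambda>(x, p, \<mu>). p\<^sup>2 * (- q * E x) * u (x, p, \<mu>) * \<mu> * deriv (\<lambda>r. w x r \<mu>) p) = integral ?C T2"
    "integral (cell D i k m) (\<lambda>(x, p, \<mu>). (1 - \<mu>\<^sup>2) * u (x, p, \<mu>) * (- q * E x) * deriv (\<lambda>n. w x p n) \<mu> * p) = integral ?C T3"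
    unfolding cell_def T1_def T2_def T3_def
    by (rule integral_brick_cong; simp add: deriv_w u_cell[OF cell])+
  have "integral ?C T1 + integral ?C T2 + integral ?C T3 = integral ?C (\<lambda>z. T1 z + T2 z + T3 z)"
    using cont by (simp add: integral_add integrable_add integrable_brick)
  \<comment> \<open>\<open>T1 - A1'\<close> is half of \<open>q * E x * \<mu> * B' p * p^2\<close>
    times \<open>W\<close>, and \<open>T2 - A2'\<close> contains its negative: the field annihilates
    \<open>H\<close>. What remains of \<open>T2 - A2'\<close> is \<open>q * E x * \<mu> * p\<close>
    times \<open>W\<close>, and \<open>T3 - A3'\<close> is its negative: the field is
    divergence-free.\<close>
  also have "\<dots> = integral ?C (\<lambda>z. A1' z + A2' z + A3' z)"
    by (rule integral_cong) (auto simp: defs W_def algebra_simps power2_eq_square)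
  also have "\<dots> = integral ?C A1' + integral ?C A2' + integral ?C A3'"
    using cont by (simp add: integral_add integrable_add integrable_brick)
  also have "integral ?C A1' = integral (CP k \<times> CM m) (\<lambda>(p, \<mu>). A1 (xs D (Suc i), p, \<mu>) - A1 (xs D i, p, \<mu>))"
  proof (rule integral_brick_deriv_1)
    fix x p \<mu> assume *: "x \<in> CX i" "p \<in> CP k" "\<mu> \<in> CM m"
    then have x: "0 \<le> x" "x \<le> len D" using mesh_subset[of i] cell by auto
    have "((\<lambda>y. H y p) has_real_derivative q * E x) (at x within CX i)"
      by (rule has_field_derivative_subset[OF has_derivative_H(1)[OF x]]) (use mesh_subset[of i] cell in auto)
    then show "((\<lambda>s. A1 (s, p, \<mu>)) has_real_derivative A1' (x, p, \<mu>)) (at x within CX i)"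
      unfolding A1_def A1'_def W_def
      by (auto intro!: derivative_eq_intros has_field_derivative_at_within[OF has_real_derivative_poly3(1)]
          simp: algebra_simps power2_eq_square)
  qed (use cont less_imp_le[OF mesh_less(1)[OF cell(1)]] in simp_all)
  also have "integral ?C A2' = integral (CX i \<times> CM m) (\<lambda>(x, \<mu>). A2 (x, ps D (Suc k), \<mu>) - A2 (x, ps D k, \<mu>))"
  proof (rule integral_brick_deriv_2)
    fix x p \<mu> assume *: "x \<in> CX i" "p \<in> CP k" "\<mu> \<in> CM m"
    then have p: "0 \<le> p" "p \<le> pmax D" using mesh_subset[of k] cell by auto
    show "((\<lambda>s. A2 (x, s, \<mu>)) has_real_derivative A2' (x, p, \<mu>)) (at p within CP k)"
      unfolding A2_def A2'_def W_def prod.case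
      by (rule has_field_derivative_at_within)
        (auto intro!: derivative_eq_intros has_real_derivative_poly3 has_derivative_H(2) p
          simp: algebra_simps power2_eq_square)
  qed (use cont less_imp_le[OF mesh_less(2)[OF cell(2)]] in simp_all)
  also have "integral ?C A3' = integral (CX i \<times> CP k) (\<lambda>(x, p). A3 (x, p, ms D (Suc m)) - A3 (x, p, ms D m))"
  proof (rule integral_brick_deriv_3)
    fix x p \<mu>
    show "((\<lambda>s. A3 (x, p, s)) has_real_derivative A3' (x, p, \<mu>)) (at \<mu> within CM m)"
      unfolding A3_def A3'_def W_def prod.case
      by (rule has_field_derivative_at_within)
        (auto intro!: derivative_eq_intros has_real_derivative_poly3
          simp: algebra_simps power2_eq_square)
  qed (use cont less_imp_le[OF mesh_less(3)[OF cell(3)]] in simp_all)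
  finally show ?thesis
    unfolding T A1_def A2_def A3_def prod.case by (simp add: right_diff_distrib case_prod_unfold)
qed

section \<open>Numerical fluxes and traces at the faces of a cell\<close>

lemma face_values_x:
  assumes "ps D k < p" "p < ps D (Suc k)" "ms D m < \<mu>" "\<mu> < ms D (Suc m)"
  shows "flux_x D u (xs D (Suc i)) p \<mu> = upwind \<mu> (P i k m (xs D (Suc i), p, \<mu>))
      (P (nxt (nx D) i) k m (xs D (nxt (nx D) i), p, \<mu>))"
    and "flux_x D u (xs D i) p \<mu> = upwind \<mu>
      (P (prv (nx D) i) k m (xs D (Suc (prv (nx D) i)), p, \<mu>)) (P i k m (xs D i, p, \<mu>))"
    and "Lim (at_left (xs D (Suc i))) (\<lambda>y. w y p \<mu>) = P i k m (xs D (Suc i), p, \<mu>) * exp (H (xs D (Suc i)) p)"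
    and "Lim (at_right (xs D i)) (\<lambda>y. w y p \<mu>) = P i k m (xs D i, p, \<mu>) * exp (H (xs D i) p)"
proof -
  have c: "continuous_on {xs D i..xs D (Suc i)} (\<lambda>y. P i k m (y, p, \<mu>))" for i
    by (intro basic_continuous_intros continuous_on_poly3)
  have e: "u (y, p, \<mu>) = P i k m (y, p, \<mu>)" if "i < nx D" "xs D i < y" "y < xs D (Suc i)" for i y
    using that assms cell by (intro u_cell) auto
  show "flux_x D u (xs D (Suc i)) p \<mu> = upwind \<mu> (P i k m (xs D (Suc i), p, \<mu>))
      (P (nxt (nx D) i) k m (xs D (nxt (nx D) i), p, \<mu>))"
    unfolding flux_x_def
    by (simp only: piecewise_trace_below_upper[where h = "\<lambda>i y. P i k m (y, p, \<mu>)", OF nodes_x c e cell(1)]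
        piecewise_trace_above_upper[where h = "\<lambda>i y. P i k m (y, p, \<mu>)", OF nodes_x c e cell(1)])
  show "flux_x D u (xs D i) p \<mu> = upwind \<mu>
      (P (prv (nx D) i) k m (xs D (Suc (prv (nx D) i)), p, \<mu>)) (P i k m (xs D i, p, \<mu>))"
    unfolding flux_x_def
    by (simp only: piecewise_trace_below_lower[where h = "\<lambda>i y. P i k m (y, p, \<mu>)", OF nodes_x c e cell(1)]
        piecewise_trace_above_lower[where h = "\<lambda>i y. P i k m (y, p, \<mu>)", OF nodes_x c e cell(1)])
  have cw: "continuous_on {xs D i..xs D (Suc i)} (\<lambda>y. P i k m (y, p, \<mu>) * exp (H y p))" if "i < nx D" for i
    unfolding H_def using mesh_subset(1)[OF that]
    by (intro basic_continuous_intros continuous_on_poly3 continuous_on_coefs) auto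
  have ew: "w y p \<mu> = P i k m (y, p, \<mu>) * exp (H y p)" if "i < nx D" "xs D i < y" "y < xs D (Suc i)" for i y
    using e[OF that] by (simp add: w_def)
  show "Lim (at_left (xs D (Suc i))) (\<lambda>y. w y p \<mu>) = P i k m (xs D (Suc i), p, \<mu>) * exp (H (xs D (Suc i)) p)"
    by (rule piecewise_Lim_left[where h = "\<lambda>i y. P i k m (y, p, \<mu>) * exp (H y p)", OF nodes_x cw ew cell(1)])
  show "Lim (at_right (xs D i)) (\<lambda>y. w y p \<mu>) = P i k m (xs D i, p, \<mu>) * exp (H (xs D i) p)"
    by (rule piecewise_Lim_right[where h = "\<lambda>i y. P i k m (y, p, \<mu>) * exp (H y p)", OF nodes_x cw ew cell(1)])
qed

text \<open>The branches for the flux are \<open>y * P i k m (x, y, \<mu>)\<close>, because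
  \<open>flux_p\<close> takes traces of p f_h; the traces of the test function carry no such
  factor.\<close>

lemma face_values_p:
  assumes "xs D i < x" "x < xs D (Suc i)" "ms D m < \<mu>" "\<mu> < ms D (Suc m)"
  shows "flux_p D E u x (ps D (Suc k)) \<mu> = upwind (- q * E x * \<mu>) (ps D (Suc k) * P i k m (x, ps D (Suc k), \<mu>))
      (ps D (nxt (np D) k) * P i (nxt (np D) k) m (x, ps D (nxt (np D) k), \<mu>))"
    and "flux_p D E u x (ps D k) \<mu> = upwind (- q * E x * \<mu>)
      (ps D (Suc (prv (np D) k)) * P i (prv (np D) k) m (x, ps D (Suc (prv (np D) k)), \<mu>)) (ps D k * P i k m (x, ps D k, \<mu>))"
    and "Lim (at_left (ps D (Suc k))) (\<lambda>r. w x r \<mu>) = P i k m (x, ps D (Suc k), \<mu>) * exp (H x (ps D (Suc k)))"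
    and "Lim (at_right (ps D k)) (\<lambda>r. w x r \<mu>) = P i k m (x, ps D k, \<mu>) * exp (H x (ps D k))"
proof -
  have c: "continuous_on {ps D k..ps D (Suc k)} (\<lambda>y. y * P i k m (x, y, \<mu>))" for k
    by (intro basic_continuous_intros continuous_on_poly3)
  have e: "u (x, y, \<mu>) = P i k m (x, y, \<mu>)" if "k < np D" "ps D k < y" "y < ps D (Suc k)" for k y
    using that assms cell by (intro u_cell) auto
  then have e': "y * u (x, y, \<mu>) = y * P i k m (x, y, \<mu>)" if "k < np D" "ps D k < y" "y < ps D (Suc k)" for k y
    using that by simp
  show "flux_p D E u x (ps D (Suc k)) \<mu> = upwind (- q * E x * \<mu>) (ps D (Suc k) * P i k m (x, ps D (Suc k), \<mu>))
      (ps D (nxt (np D) k) * P i (nxt (np D) k) m (x, ps D (nxt (np D) k), \<mu>))"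
    unfolding flux_p_def
    by (simp only: piecewise_trace_below_upper[where h = "\<lambda>k y. y * P i k m (x, y, \<mu>)", OF nodes_p c e' cell(2)]
        piecewise_trace_above_upper[where h = "\<lambda>k y. y * P i k m (x, y, \<mu>)", OF nodes_p c e' cell(2)])
  show "flux_p D E u x (ps D k) \<mu> = upwind (- q * E x * \<mu>)
      (ps D (Suc (prv (np D) k)) * P i (prv (np D) k) m (x, ps D (Suc (prv (np D) k)), \<mu>)) (ps D k * P i k m (x, ps D k, \<mu>))"
    unfolding flux_p_def
    by (simp only: piecewise_trace_below_lower[where h = "\<lambda>k y. y * P i k m (x, y, \<mu>)", OF nodes_p c e' cell(2)]
        piecewise_trace_above_lower[where h = "\<lambda>k y. y * P i k m (x, y, \<mu>)", OF nodes_p c e' cell(2)])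
  have cw: "continuous_on {ps D k..ps D (Suc k)} (\<lambda>y. P i k m (x, y, \<mu>) * exp (H x y))" if "k < np D" for k
    unfolding H_def using mesh_subset(2)[OF that]
    by (intro basic_continuous_intros continuous_on_poly3 continuous_on_coefs) auto
  have ew: "w x y \<mu> = P i k m (x, y, \<mu>) * exp (H x y)" if "k < np D" "ps D k < y" "y < ps D (Suc k)" for k y
    using e[OF that] by (simp add: w_def)
  show "Lim (at_left (ps D (Suc k))) (\<lambda>r. w x r \<mu>) = P i k m (x, ps D (Suc k), \<mu>) * exp (H x (ps D (Suc k)))"
    by (rule piecewise_Lim_left[where h = "\<lambda>k y. P i k m (x, y, \<mu>) * exp (H x y)", OF nodes_p cw ew cell(2)])
  show "Lim (at_right (ps D k)) (\<lambda>r. w x r \<mu>) = P i k m (x, ps D k, \<mu>) * exp (H x (ps D k))"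
    by (rule piecewise_Lim_right[where h = "\<lambda>k y. P i k m (x, y, \<mu>) * exp (H x y)", OF nodes_p cw ew cell(2)])
qed

lemma face_values_m:
  assumes "xs D i < x" "x < xs D (Suc i)" "ps D k < p" "p < ps D (Suc k)"
  shows "flux_mu D E u x p (ms D (Suc m)) = upwind (- q * E x) (P i k m (x, p, ms D (Suc m)))
      (P i k (nxt (nm D) m) (x, p, ms D (nxt (nm D) m)))"
    and "flux_mu D E u x p (ms D m) = upwind (- q * E x)
      (P i k (prv (nm D) m) (x, p, ms D (Suc (prv (nm D) m)))) (P i k m (x, p, ms D m))"
    and "Lim (at_left (ms D (Suc m))) (\<lambda>n. w x p n) = P i k m (x, p, ms D (Suc m)) * exp (H x p)"
    and "Lim (at_right (ms D m)) (\<lambda>n. w x p n) = P i k m (x, p, ms D m) * exp (H x p)"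
proof -
  have c: "continuous_on {ms D m..ms D (Suc m)} (\<lambda>y. P i k m (x, p, y))" for m
    by (intro basic_continuous_intros continuous_on_poly3)
  have e: "u (x, p, y) = P i k m (x, p, y)" if "m < nm D" "ms D m < y" "y < ms D (Suc m)" for m y
    using that assms cell by (intro u_cell) auto
  show "flux_mu D E u x p (ms D (Suc m)) = upwind (- q * E x) (P i k m (x, p, ms D (Suc m)))
      (P i k (nxt (nm D) m) (x, p, ms D (nxt (nm D) m)))"
    unfolding flux_mu_def
    by (simp only: piecewise_trace_below_upper[where h = "\<lambda>m y. P i k m (x, p, y)", OF nodes_m c e cell(3)]
        piecewise_trace_above_upper[where h = "\<lambda>m y. P i k m (x, p, y)", OF nodes_m c e cell(3)])
  show "flux_mu D E u x p (ms D m) = upwind (- q * E x)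
      (P i k (prv (nm D) m) (x, p, ms D (Suc (prv (nm D) m)))) (P i k m (x, p, ms D m))"
    unfolding flux_mu_def
    by (simp only: piecewise_trace_below_lower[where h = "\<lambda>m y. P i k m (x, p, y)", OF nodes_m c e cell(3)]
        piecewise_trace_above_lower[where h = "\<lambda>m y. P i k m (x, p, y)", OF nodes_m c e cell(3)])
  have cw: "continuous_on {ms D m..ms D (Suc m)} (\<lambda>y. P i k m (x, p, y) * exp (H x p))" for m
    by (intro basic_continuous_intros continuous_on_poly3)
  have ew: "w x p y = P i k m (x, p, y) * exp (H x p)" if "m < nm D" "ms D m < y" "y < ms D (Suc m)" for m y
    using e[OF that] by (simp add: w_def)
  show "Lim (at_left (ms D (Suc m))) (\<lambda>n. w x p n) = P i k m (x, p, ms D (Suc m)) * exp (H x p)"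
    by (rule piecewise_Lim_left[where h = "\<lambda>m y. P i k m (x, p, y) * exp (H x p)", OF nodes_m cw ew cell(3)])
  show "Lim (at_right (ms D m)) (\<lambda>n. w x p n) = P i k m (x, p, ms D m) * exp (H x p)"
    by (rule piecewise_Lim_right[where h = "\<lambda>m y. P i k m (x, p, y) * exp (H x p)", OF nodes_m cw ew cell(3)])
qed

end

text \<open>The speed in x is \<mu> times the positive \<open>B' p\<close>. The factor
  \<open>B' p\<close> goes into the weight together with p^2, so that the upwind direction is
  decided by \<mu> alone, as in \<open>flux_x\<close>.\<close>

definition jump_x :: "nat \<Rightarrow> nat \<Rightarrow> nat \<Rightarrow> real \<times> real \<Rightarrow> real" where
  "jump_x i k m = (\<lambda>(p, \<mu>). jump (nx D) \<mu>
     (\<lambda>i. P i k m (xs D (Suc i), p, \<mu>)) (\<lambda>i. P i k m (xs D i, p, \<mu>))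
     (\<lambda>i. B' p * p\<^sup>2 * exp (H (xs D (Suc i)) p)) (\<lambda>i. B' p * p\<^sup>2 * exp (H (xs D i) p)) i)"

text \<open>The face weight p^2 is shared by two traces, each of which takes one factor
  \<open>ps\<close>; the weight is then \<open>exp H\<close> alone. At the identified faces these
  weights differ, but the lower trace has the factor \<open>ps D 0 = 0\<close>.\<close>

definition jump_p :: "nat \<Rightarrow> nat \<Rightarrow> nat \<Rightarrow> real \<times> real \<Rightarrow> real" where
  "jump_p i k m = (\<lambda>(x, \<mu>). jump (np D) (- q * E x * \<mu>)
     (\<lambda>k. ps D (Suc k) * P i k m (x, ps D (Suc k), \<mu>)) (\<lambda>k. ps D k * P i k m (x, ps D k, \<mu>))
     (\<lambda>k. exp (H x (ps D (Suc k)))) (\<lambda>k. exp (H x (ps D k))) k)"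

text \<open>Here the weight depends on the face only through 1 - \<mu>^2, which takes the same
  value, zero, at \<mu> = -1 and \<mu> = 1.\<close>

definition jump_m :: "nat \<Rightarrow> nat \<Rightarrow> nat \<Rightarrow> real \<times> real \<Rightarrow> real" where
  "jump_m i k m = (\<lambda>(x, p). jump (nm D) (- q * E x)
     (\<lambda>m. P i k m (x, p, ms D (Suc m))) (\<lambda>m. P i k m (x, p, ms D m))
     (\<lambda>m. (1 - (ms D (Suc m))\<^sup>2) * p * exp (H x p)) (\<lambda>m. (1 - (ms D m)\<^sup>2) * p * exp (H x p)) m)"

context
  fixes i k m :: nat
  assumes cell: "i < nx D" "k < np D" "m < nm D"
begin

lemma continuous_on_faces:
  "continuous_on (CP k \<times> CM m) (\<lambda>z. B (fst z))"
  "continuous_on (CP k \<times> CM m) (\<lambda>z. B' (fst z))"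
  "continuous_on (CX i \<times> CM m) (\<lambda>z. \<phi> (fst z))"
  "continuous_on (CX i \<times> CM m) (\<lambda>z. E (fst z))"
  "continuous_on (CX i \<times> CP k) (\<lambda>z. \<phi> (fst z))"
  "continuous_on (CX i \<times> CP k) (\<lambda>z. E (fst z))"
  "continuous_on (CX i \<times> CP k) (\<lambda>z. B (snd z))"
  using mesh_subset(1)[OF cell(1)] mesh_subset(2)[OF cell(2)]
  by (auto intro!: continuous_on_coefs continuous_on_fst continuous_on_snd)

lemma integrable_jumps:
  "jump_x i k m integrable_on CP k \<times> CM m" "jump_p i k m integrable_on CX i \<times> CM m"
  "jump_m i k m integrable_on CX i \<times> CP k"
  unfolding jump_x_def jump_p_def jump_m_def jump_def upwind_def H_def case_prod_unfold
  by (rule integrable_rect; intro basic_continuous_intros continuous_on_poly3 continuous_on_faces; simp)+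

text \<open>The third integral is the half flux left by \<open>volume_terms\<close>. The three are
  merged into one integrand because nonnegativity emerges only pointwise on the face, after
  summation over \<open>i\<close>.\<close>

lemma face_terms_x:
  "integral (CP k \<times> CM m) (\<lambda>(p, \<mu>). B' p * flux_x D u (xs D (Suc i)) p \<mu> * Lim (at_left (xs D (Suc i))) (\<lambda>y. w y p \<mu>) * p\<^sup>2)
   - integral (CP k \<times> CM m) (\<lambda>(p, \<mu>). B' p * flux_x D u (xs D i) p \<mu> * Lim (at_right (xs D i)) (\<lambda>y. w y p \<mu>) * p\<^sup>2)
   - integral (CP k \<times> CM m) (\<lambda>(p, \<mu>). \<mu> / 2 * (B' p * p\<^sup>2 * W i k m (xs D (Suc i)) p \<mu> - B' p * p\<^sup>2 * W i k m (xs D i) p \<mu>))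
   = integral (CP k \<times> CM m) (jump_x i k m)"
proof -
  define f1 where "f1 = (\<lambda>(p, \<mu>). B' p * upwind \<mu> (P i k m (xs D (Suc i), p, \<mu>))
      (P (nxt (nx D) i) k m (xs D (nxt (nx D) i), p, \<mu>)) * (P i k m (xs D (Suc i), p, \<mu>) * exp (H (xs D (Suc i)) p)) * p\<^sup>2)"
  define f2 where "f2 = (\<lambda>(p, \<mu>). B' p * upwind \<mu>
      (P (prv (nx D) i) k m (xs D (Suc (prv (nx D) i)), p, \<mu>)) (P i k m (xs D i, p, \<mu>))
      * (P i k m (xs D i, p, \<mu>) * exp (H (xs D i) p)) * p\<^sup>2)"
  define f3 where "f3 = (\<lambda>(p, \<mu>). \<mu> / 2 * (B' p * p\<^sup>2 * W i k m (xs D (Suc i)) p \<mu> - B' p * p\<^sup>2 * W i k m (xs D i) p \<mu>))"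
  have "integral (CP k \<times> CM m) (\<lambda>(p, \<mu>). B' p * flux_x D u (xs D (Suc i)) p \<mu> * Lim (at_left (xs D (Suc i))) (\<lambda>y. w y p \<mu>) * p\<^sup>2)
      = integral (CP k \<times> CM m) f1"
    by (rule integral_rect_cong) (simp add: f1_def face_values_x[OF cell])
  moreover have "integral (CP k \<times> CM m) (\<lambda>(p, \<mu>). B' p * flux_x D u (xs D i) p \<mu> * Lim (at_right (xs D i)) (\<lambda>y. w y p \<mu>) * p\<^sup>2)
      = integral (CP k \<times> CM m) f2"
    by (rule integral_rect_cong) (simp add: f2_def face_values_x[OF cell])
  moreover have "integral (CP k \<times> CM m) f1 - integral (CP k \<times> CM m) f2 - integral (CP k \<times> CM m) f3
      = integral (CP k \<times> CM m) (jump_x i k m)"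
  proof (rule integral_combine3)
    show "f1 integrable_on CP k \<times> CM m" "f2 integrable_on CP k \<times> CM m" "f3 integrable_on CP k \<times> CM m"
      unfolding f1_def f2_def f3_def W_def upwind_def H_def case_prod_unfold
      by (rule integrable_rect; intro basic_continuous_intros continuous_on_poly3 continuous_on_faces; simp)+
    show "f1 z - f2 z - f3 z = jump_x i k m z" for z
      by (cases z) (simp add: f1_def f2_def f3_def jump_x_def jump_def W_def algebra_simps)
  qed
  ultimately show ?thesis by (simp add: f3_def)
qed

lemma face_terms_p:
  "integral (CX i \<times> CM m) (\<lambda>(x, \<mu>). ps D (Suc k) * flux_p D E u x (ps D (Suc k)) \<mu> * Lim (at_left (ps D (Suc k))) (\<lambda>r. w x r \<mu>))
   - integral (CX i \<times> CM m) (\<lambda>(x, \<mu>). ps D k * flux_p D E u x (ps D k) \<mu> * Lim (at_right (ps D k)) (\<lambda>r. w x r \<mu>))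
   - integral (CX i \<times> CM m) (\<lambda>(x, \<mu>). - q * E x * \<mu> / 2 * ((ps D (Suc k))\<^sup>2 * W i k m x (ps D (Suc k)) \<mu> - (ps D k)\<^sup>2 * W i k m x (ps D k) \<mu>))
   = integral (CX i \<times> CM m) (jump_p i k m)"
proof -
  define f1 where "f1 = (\<lambda>(x, \<mu>). ps D (Suc k) * upwind (- q * E x * \<mu>) (ps D (Suc k) * P i k m (x, ps D (Suc k), \<mu>))
      (ps D (nxt (np D) k) * P i (nxt (np D) k) m (x, ps D (nxt (np D) k), \<mu>)) * (P i k m (x, ps D (Suc k), \<mu>) * exp (H x (ps D (Suc k)))))"
  define f2 where "f2 = (\<lambda>(x, \<mu>). ps D k * upwind (- q * E x * \<mu>)
      (ps D (Suc (prv (np D) k)) * P i (prv (np D) k) m (x, ps D (Suc (prv (np D) k)), \<mu>)) (ps D k * P i k m (x, ps D k, \<mu>))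
      * (P i k m (x, ps D k, \<mu>) * exp (H x (ps D k))))"
  define f3 where "f3 = (\<lambda>(x, \<mu>). - q * E x * \<mu> / 2 * ((ps D (Suc k))\<^sup>2 * W i k m x (ps D (Suc k)) \<mu> - (ps D k)\<^sup>2 * W i k m x (ps D k) \<mu>))"
  have "integral (CX i \<times> CM m) (\<lambda>(x, \<mu>). ps D (Suc k) * flux_p D E u x (ps D (Suc k)) \<mu> * Lim (at_left (ps D (Suc k))) (\<lambda>r. w x r \<mu>))
      = integral (CX i \<times> CM m) f1"
    by (rule integral_rect_cong) (simp add: f1_def face_values_p[OF cell])
  moreover have "integral (CX i \<times> CM m) (\<lambda>(x, \<mu>). ps D k * flux_p D E u x (ps D k) \<mu> * Lim (at_right (ps D k)) (\<lambda>r. w x r \<mu>))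
      = integral (CX i \<times> CM m) f2"
    by (rule integral_rect_cong) (simp add: f2_def face_values_p[OF cell])
  moreover have "integral (CX i \<times> CM m) f1 - integral (CX i \<times> CM m) f2 - integral (CX i \<times> CM m) f3
      = integral (CX i \<times> CM m) (jump_p i k m)"
  proof (rule integral_combine3)
    show "f1 integrable_on CX i \<times> CM m" "f2 integrable_on CX i \<times> CM m" "f3 integrable_on CX i \<times> CM m"
      unfolding f1_def f2_def f3_def W_def upwind_def H_def case_prod_unfold
      by (rule integrable_rect; intro basic_continuous_intros continuous_on_poly3 continuous_on_faces; simp)+
    show "f1 z - f2 z - f3 z = jump_p i k m z" for z
      by (cases z) (simp add: f1_def f2_def f3_def jump_p_def jump_def W_def power_mult_distrib algebra_simps)
  qed
  ultimately show ?thesis by (simp add: f3_def)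
qed

lemma face_terms_m:
  "integral (CX i \<times> CP k) (\<lambda>(x, p). (1 - (ms D (Suc m))\<^sup>2) * flux_mu D E u x p (ms D (Suc m)) * Lim (at_left (ms D (Suc m))) (\<lambda>n. w x p n) * p)
   - integral (CX i \<times> CP k) (\<lambda>(x, p). (1 - (ms D m)\<^sup>2) * flux_mu D E u x p (ms D m) * Lim (at_right (ms D m)) (\<lambda>n. w x p n) * p)
   - integral (CX i \<times> CP k) (\<lambda>(x, p). - q * E x / 2 * ((1 - (ms D (Suc m))\<^sup>2) * p * W i k m x p (ms D (Suc m)) - (1 - (ms D m)\<^sup>2) * p * W i k m x p (ms D m)))
   = integral (CX i \<times> CP k) (jump_m i k m)"
proof -
  define f1 where "f1 = (\<lambda>(x, p). (1 - (ms D (Suc m))\<^sup>2) * upwind (- q * E x) (P i k m (x, p, ms D (Suc m)))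
      (P i k (nxt (nm D) m) (x, p, ms D (nxt (nm D) m))) * (P i k m (x, p, ms D (Suc m)) * exp (H x p)) * p)"
  define f2 where "f2 = (\<lambda>(x, p). (1 - (ms D m)\<^sup>2) * upwind (- q * E x)
      (P i k (prv (nm D) m) (x, p, ms D (Suc (prv (nm D) m)))) (P i k m (x, p, ms D m)) * (P i k m (x, p, ms D m) * exp (H x p)) * p)"
  define f3 where "f3 = (\<lambda>(x, p). - q * E x / 2 * ((1 - (ms D (Suc m))\<^sup>2) * p * W i k m x p (ms D (Suc m)) - (1 - (ms D m)\<^sup>2) * p * W i k m x p (ms D m)))"
  have "integral (CX i \<times> CP k) (\<lambda>(x, p). (1 - (ms D (Suc m))\<^sup>2) * flux_mu D E u x p (ms D (Suc m)) * Lim (at_left (ms D (Suc m))) (\<lambda>n. w x p n) * p)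
      = integral (CX i \<times> CP k) f1"
    by (rule integral_rect_cong) (simp add: f1_def face_values_m[OF cell])
  moreover have "integral (CX i \<times> CP k) (\<lambda>(x, p). (1 - (ms D m)\<^sup>2) * flux_mu D E u x p (ms D m) * Lim (at_right (ms D m)) (\<lambda>n. w x p n) * p)
      = integral (CX i \<times> CP k) f2"
    by (rule integral_rect_cong) (simp add: f2_def face_values_m[OF cell])
  moreover have "integral (CX i \<times> CP k) f1 - integral (CX i \<times> CP k) f2 - integral (CX i \<times> CP k) f3
      = integral (CX i \<times> CP k) (jump_m i k m)"
  proof (rule integral_combine3)
    show "f1 integrable_on CX i \<times> CP k" "f2 integrable_on CX i \<times> CP k" "f3 integrable_on CX i \<times> CP k"
      unfolding f1_def f2_def f3_def W_def upwind_def H_def case_prod_unfold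
      by (rule integrable_rect; intro basic_continuous_intros continuous_on_poly3 continuous_on_faces; simp)+
    show "f1 z - f2 z - f3 z = jump_m i k m z" for z
      by (cases z) (simp add: f1_def f2_def f3_def jump_m_def jump_def W_def algebra_simps)
  qed
  ultimately show ?thesis by (simp add: f3_def)
qed

lemma cell_energy_balance:
  assumes "dg_equation D E H u u' u i k m"
  shows "integral (cell D i k m) (\<lambda>(x, p, \<mu>). u (x, p, \<mu>) * u' (x, p, \<mu>) * exp (H x p) * p\<^sup>2)
       + integral (CP k \<times> CM m) (jump_x i k m) + integral (CX i \<times> CM m) (jump_p i k m)
       + integral (CX i \<times> CP k) (jump_m i k m)
     = integral (cell D i k m) (\<lambda>(x, p, \<mu>). collision D (\<lambda>(p', \<mu>'). u (x, p', \<mu>')) (p, \<mu>) * u (x, p, \<mu>) * exp (H x p) * p\<^sup>2)"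
proof -
  have "integral (cell D i k m) (\<lambda>(x, p, \<mu>). u' (x, p, \<mu>) * w x p \<mu> * p\<^sup>2)
      = integral (cell D i k m) (\<lambda>(x, p, \<mu>). u (x, p, \<mu>) * u' (x, p, \<mu>) * exp (H x p) * p\<^sup>2)"
    by (rule integral_cong) (auto simp: w_def)
  moreover have "integral (cell D i k m) (\<lambda>(x, p, \<mu>). collision D (\<lambda>(p', \<mu>'). u (x, p', \<mu>')) (p, \<mu>) * w x p \<mu> * p\<^sup>2)
      = integral (cell D i k m) (\<lambda>(x, p, \<mu>). collision D (\<lambda>(p', \<mu>'). u (x, p', \<mu>')) (p, \<mu>) * u (x, p, \<mu>) * exp (H x p) * p\<^sup>2)"
    by (rule integral_cong) (auto simp: w_def)
  moreover note assms[unfolded dg_equation_def Let_def, folded w_def]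
  ultimately show ?thesis
    using volume_terms[OF cell] face_terms_x face_terms_p face_terms_m by linarith
qed

end

subsection \<open>Summation over the mesh\<close>

text \<open>All cells of a row in x share the same rectangle of (p, \<mu>), so the sum can be taken
  under the integral, where \<open>upwind_cyclic_sum_nonneg\<close> applies at each point. The
  weights on the two sides of the identified face agree because the potential is periodic.\<close>

lemma jump_x_sum_nonneg:
  assumes "k < np D" "m < nm D"
  shows "0 \<le> (\<Sum>i<nx D. integral (CP k \<times> CM m) (jump_x i k m))"
proof -
  have int: "jump_x i k m integrable_on CP k \<times> CM m" if "i < nx D" for i
    using integrable_jumps that assms by blast
  have "0 \<le> (\<Sum>i<nx D. jump_x i k m z)" if "z \<in> CP k \<times> CM m" for z
  proof -
    obtain p \<mu> where [simp]: "z = (p, \<mu>)" by (cases z) auto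
    have "0 < B' p"
      using that mesh_subset(2)[OF assms(1)] by (intro bp_model_band(2)[OF model]) auto
    moreover have "\<phi> (xs D (nxt (nx D) i)) = \<phi> (xs D (Suc i))" for i
      using mesh_end potential_periodic by (auto simp: nxt_def)
    ultimately show ?thesis
      unfolding jump_x_def jump_def \<open>z = (p, \<mu>)\<close> prod.case
      by (intro upwind_cyclic_sum_nonneg) (auto simp: H_def)
  qed
  then have "0 \<le> integral (CP k \<times> CM m) (\<lambda>z. \<Sum>i<nx D. jump_x i k m z)"
    using int by (intro integral_nonneg integrable_sum) auto
  then show ?thesis using int by (subst (asm) integral_sum) auto
qed

lemma jump_p_sum_nonneg:
  assumes "i < nx D" "m < nm D"
  shows "0 \<le> (\<Sum>k<np D. integral (CX i \<times> CM m) (jump_p i k m))"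
proof -
  have int: "jump_p i k m integrable_on CX i \<times> CM m" if "k < np D" for k
    using integrable_jumps that assms by blast
  have "0 \<le> (\<Sum>k<np D. jump_p i k m z)" for z
  proof -
    obtain x \<mu> where [simp]: "z = (x, \<mu>)" by (cases z) auto
    show ?thesis
      unfolding jump_p_def jump_def \<open>z = (x, \<mu>)\<close> prod.case
      by (intro upwind_cyclic_sum_nonneg) (auto simp: nxt_def mesh_end)
  qed
  then have "0 \<le> integral (CX i \<times> CM m) (\<lambda>z. \<Sum>k<np D. jump_p i k m z)"
    using int by (intro integral_nonneg integrable_sum) auto
  then show ?thesis using int by (subst (asm) integral_sum) auto
qed

lemma jump_m_sum_nonneg:
  assumes "i < nx D" "k < np D"
  shows "0 \<le> (\<Sum>m<nm D. integral (CX i \<times> CP k) (jump_m i k m))"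
proof -
  have int: "jump_m i k m integrable_on CX i \<times> CP k" if "m < nm D" for m
    using integrable_jumps that assms by blast
  have "0 \<le> (\<Sum>m<nm D. jump_m i k m z)" if "z \<in> CX i \<times> CP k" for z
  proof -
    obtain x p where [simp]: "z = (x, p)" by (cases z) auto
    have "0 \<le> p" using that mesh_subset(2)[OF assms(2)] by auto
    moreover have "(ms D (Suc m))\<^sup>2 \<le> 1" if "m < nm D" for m
      using mesh_bounds(5,6)[of "Suc m"] that by (simp add: abs_square_le_1 abs_le_iff)
    ultimately show ?thesis
      unfolding jump_m_def jump_def \<open>z = (x, p)\<close> prod.case
      by (intro upwind_cyclic_sum_nonneg) (auto simp: nxt_def mesh_end)
  qed
  then have "0 \<le> integral (CX i \<times> CP k) (\<lambda>z. \<Sum>m<nm D. jump_m i k m z)"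
    using int by (intro integral_nonneg integrable_sum) auto
  then show ?thesis using int by (subst (asm) integral_sum) auto
qed

section \<open>Decomposition of the phase domain into cells up to the mesh planes\<close>

definition grid :: "(real \<times> real \<times> real) set" where
  "grid = {z. fst z \<in> xs D ` {..nx D}} \<union> {z. fst (snd z) \<in> ps D ` {..np D}}
     \<union> {z. snd (snd z) \<in> ms D ` {..nm D}}"

lemma negligible_grid: "negligible grid"
  unfolding grid_def by (intro negligible_Un negligible_coordinate) auto

definition cells :: "(nat \<times> nat \<times> nat) set" where
  "cells = {..<nx D} \<times> {..<np D} \<times> {..<nm D}"

lemma finite_cells: "finite cells"
  by (simp add: cells_def)

lemma sum_cells: "(\<Sum>(i, k, m)\<in>cells. f i k m) = (\<Sum>i<nx D. \<Sum>k<np D. \<Sum>m<nm D. f i k m)"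
  by (simp add: cells_def sum.cartesian_product)

lemma cell_minus_grid:
  assumes "i < nx D" "k < np D" "m < nm D" "z \<in> cell D i k m" "z \<notin> grid"
  shows "z \<in> interior (cell D i k m)"
proof -
  obtain x p \<mu> where [simp]: "z = (x, p, \<mu>)" by (cases z) auto
  have "x \<noteq> xs D i" "x \<noteq> xs D (Suc i)" "p \<noteq> ps D k" "p \<noteq> ps D (Suc k)" "\<mu> \<noteq> ms D m" "\<mu> \<noteq> ms D (Suc m)"
    using assms by (auto simp: grid_def)
  then show ?thesis using assms(4) unfolding interior_cell by (auto simp: cell_def)
qed

lemma interior_cell_unique:
  assumes "(i, k, m) \<in> cells" "(i', k', m') \<in> cells"
    "z \<in> interior (cell D i k m)" "z \<in> interior (cell D i' k' m')"
  shows "(i', k', m') = (i, k, m)"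
  using assms nodes_unique[OF nodes_x, of i i' "fst z"] nodes_unique[OF nodes_p, of k k' "fst (snd z)"]
    nodes_unique[OF nodes_m, of m m' "snd (snd z)"]
  by (auto simp: cells_def interior_cell)

lemma phase_domain_cells: "phase_domain D = (\<Union>(i, k, m)\<in>cells. cell D i k m)"
proof
  have L: "0 < len D" "0 < pmax D" using model by (auto simp: bp_model_def)
  show "phase_domain D \<subseteq> (\<Union>(i, k, m)\<in>cells. cell D i k m)"
  proof
    fix z assume "z \<in> phase_domain D"
    then obtain x p \<mu> where z: "z = (x, p, \<mu>)" "0 \<le> x" "x \<le> len D" "0 \<le> p" "p \<le> pmax D" "- 1 \<le> \<mu>" "\<mu> \<le> 1"
      by (auto simp: phase_domain_def)
    obtain i where "i < nx D" "xs D i \<le> x" "x \<le> xs D (Suc i)"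
      using nodes_locate[OF nodes_x L(1) z(2,3)] .
    moreover obtain k where "k < np D" "ps D k \<le> p" "p \<le> ps D (Suc k)"
      using nodes_locate[OF nodes_p L(2) z(4,5)] .
    moreover obtain m where "m < nm D" "ms D m \<le> \<mu>" "\<mu> \<le> ms D (Suc m)"
      using nodes_locate[OF nodes_m _ z(6,7)] by auto
    ultimately show "z \<in> (\<Union>(i, k, m)\<in>cells. cell D i k m)"
      using z(1) by (auto simp: cells_def cell_def intro!: bexI[of _ "(i, k, m)"])
  qed
  show "(\<Union>(i, k, m)\<in>cells. cell D i k m) \<subseteq> phase_domain D"
  proof
    fix z assume "z \<in> (\<Union>(i, k, m)\<in>cells. cell D i k m)"
    then obtain i k m where c: "i < nx D" "k < np D" "m < nm D" and "z \<in> cell D i k m"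
      by (auto simp: cells_def)
    then have "fst z \<in> CX i" "fst (snd z) \<in> CP k" "snd (snd z) \<in> CM m" by (auto simp: cell_def)
    then have "fst z \<in> {0..len D}" "fst (snd z) \<in> {0..pmax D}" "snd (snd z) \<in> {-1..1}"
      using mesh_subset(1)[OF c(1)] mesh_subset(2)[OF c(2)] mesh_subset(3)[OF c(3)] by blast+
    then show "z \<in> phase_domain D" by (simp add: phase_domain_def mem_Times_iff)
  qed
qed

lemma cell_subset: "(i, k, m) \<in> cells \<Longrightarrow> cell D i k m \<subseteq> phase_domain D"
  using UN_upper[of "(i, k, m)" cells "\<lambda>(i, k, m). cell D i k m"] by (simp add: phase_domain_cells)

lemma has_integral_phase_domain:
  fixes f :: "real \<times> real \<times> real \<Rightarrow> real"
  assumes "\<And>i k m. (i, k, m) \<in> cells \<Longrightarrow> f integrable_on cell D i k m"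
  shows "(f has_integral (\<Sum>(i, k, m)\<in>cells. integral (cell D i k m) f)) (phase_domain D)"
  unfolding phase_domain_cells
proof (rule has_integral_UN[OF finite_cells])
  show "(f has_integral (case c of (i, k, m) \<Rightarrow> integral (cell D i k m) f)) (case c of (i, k, m) \<Rightarrow> cell D i k m)"
    if "c \<in> cells" for c
    using that assms by (auto intro: integrable_integral split: prod.splits)
  show "pairwise (\<lambda>c c'. negligible ((case c of (i, k, m) \<Rightarrow> cell D i k m) \<inter> (case c' of (i, k, m) \<Rightarrow> cell D i k m))) cells"
  proof (rule pairwiseI)
    fix c c' assume *: "c \<in> cells" "c' \<in> cells" "c \<noteq> c'"
    obtain i k m i' k' m' where [simp]: "c = (i, k, m)" "c' = (i', k', m')"
      by (cases c, cases c') auto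
    have c: "(i, k, m) \<in> cells" "(i', k', m') \<in> cells" and ne: "(i, k, m) \<noteq> (i', k', m')"
      using * by simp_all
    have "cell D i k m \<inter> cell D i' k' m' \<subseteq> grid"
    proof
      fix z assume z: "z \<in> cell D i k m \<inter> cell D i' k' m'"
      show "z \<in> grid"
      proof (rule ccontr)
        assume "z \<notin> grid"
        then have "z \<in> interior (cell D i k m)" "z \<in> interior (cell D i' k' m')"
          using cell_minus_grid c z by (auto simp: cells_def)
        then show False using interior_cell_unique[OF c, of z] ne by blast
      qed
    qed
    then show "negligible ((case c of (i, k, m) \<Rightarrow> cell D i k m) \<inter> (case c' of (i, k, m) \<Rightarrow> cell D i k m))"
      using negligible_subset[OF negligible_grid] by simp
  qed
qed

lemma phase_domain_minus_grid:
  assumes "z \<in> phase_domain D" "z \<notin> grid"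
  obtains i k m where "(i, k, m) \<in> cells" "z \<in> interior (cell D i k m)"
proof -
  obtain i k m where c: "(i, k, m) \<in> cells" "z \<in> cell D i k m"
    using assms(1) by (auto simp: phase_domain_cells)
  then have "z \<in> interior (cell D i k m)"
    using cell_minus_grid[of i k m z] assms(2) by (simp add: cells_def)
  with c(1) show ?thesis by (rule that)
qed

section \<open>Borel extension of the solution and sign of the collision term\<close>

text \<open>A Borel version of \<open>u\<close>, which itself is arbitrary on the mesh faces.\<close>

definition U :: "real \<times> real \<times> real \<Rightarrow> real" where
  "U z = (\<Sum>(i, k, m)\<in>cells. indicator (interior (cell D i k m)) z * P i k m z)"

lemma U_interior:
  assumes "(i, k, m) \<in> cells" "z \<in> interior (cell D i k m)"
  shows "U z = u z"
proof -
  have "U z = (\<Sum>c\<in>cells. if c = (i, k, m) then P i k m z else 0)"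
    unfolding U_def
  proof (rule sum.cong[OF refl])
    fix c assume c: "c \<in> cells"
    obtain i' k' m' where [simp]: "c = (i', k', m')" by (cases c) auto
    have c': "(i', k', m') \<in> cells" using c by simp
    have "z \<notin> interior (cell D i' k' m')" if "(i', k', m') \<noteq> (i, k, m)"
      using interior_cell_unique[OF assms(1) c' assms(2)] that by blast
    then show "(case c of (i, k, m) \<Rightarrow> indicator (interior (cell D i k m)) z * P i k m z)
        = (if c = (i, k, m) then P i k m z else 0)"
      using assms(2) by auto
  qed
  also have "\<dots> = P i k m z" using assms(1) finite_cells by simp
  also have "\<dots> = u z" using assms u_eq[of i k m z] by (simp add: cells_def)
  finally show ?thesis .
qed

lemma U_eq: "z \<in> phase_domain D \<Longrightarrow> z \<notin> grid \<Longrightarrow> U z = u z"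
  by (erule (1) phase_domain_minus_grid) (rule U_interior)

lemma measurable_U [measurable]: "U \<in> borel_measurable borel"
proof -
  have "poly3 d c \<in> borel_measurable borel" for c
    by (rule borel_measurable_continuous_onI[OF continuous_on_poly3_aux(1)])
  then show ?thesis
    unfolding U_def case_prod_unfold
    by (intro borel_measurable_sum borel_measurable_times borel_measurable_indicator) auto
qed

lemma U_bounded: obtains M where "0 \<le> M" "\<And>z. \<bar>U z\<bar> \<le> M"
proof -
  have "\<exists>M. \<forall>z. \<bar>indicator (interior (cell D i k m)) z * P i k m z\<bar> \<le> M" for i k m
  proof -
    have "compact (cell D i k m)" unfolding cell_def cbox_brick by (rule compact_cbox)
    then have "bounded (P i k m ` cell D i k m)"
      by (intro compact_imp_bounded compact_continuous_image continuous_on_subset[OF continuous_on_poly3_aux(1)]) auto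
    then obtain M where M: "\<forall>z\<in>cell D i k m. \<bar>P i k m z\<bar> \<le> M" by (auto simp: bounded_iff)
    have "\<bar>indicator (interior (cell D i k m)) z * P i k m z\<bar> \<le> \<bar>M\<bar>" for z
      using M interior_subset[of "cell D i k m"]
      by (cases "z \<in> interior (cell D i k m)") (auto intro: order_trans[OF _ abs_ge_self])
    then show ?thesis by blast
  qed
  then obtain M where M: "\<And>i k m z. \<bar>indicator (interior (cell D i k m)) z * P i k m z\<bar> \<le> M i k m"
    by metis
  have *: "\<bar>U z\<bar> \<le> (\<Sum>(i, k, m)\<in>cells. M i k m)" for z
    unfolding U_def case_prod_unfold by (intro order_trans[OF sum_abs] sum_mono M)
  show ?thesis by (rule that[OF order_trans[OF abs_ge_zero *[of undefined]] *])
qed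

text \<open>The collision integrand of the energy balance with \<open>U\<close> for f_h, extended by
  zero to the whole space. The indicator in x occurs a second time next to \<open>\<phi>\<close>,
  since \<open>\<phi>\<close> is controlled only on the domain and the exponent must be Borel
  everywhere.\<close>

definition entropy_rate :: "real \<times> real \<times> real \<Rightarrow> real" where
  "entropy_rate = (\<lambda>(x, p, \<mu>). indicator {0..len D} x * (indicator {0..pmax D} p * indicator {-1..1} \<mu> *
     (collisionB D (\<lambda>y. U (x, y)) (p, \<mu>) * U (x, p, \<mu>) *
       exp (bandB D p - q * (indicator {0..len D} x * \<phi> x)) * p\<^sup>2)))"

lemma entropy_rate_outside:
  "z \<notin> phase_domain D \<Longrightarrow> entropy_rate z = 0"
  "y \<notin> {0..pmax D} \<times> {-1..1} \<Longrightarrow> entropy_rate (x, y) = 0"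
  by (cases z, auto simp: entropy_rate_def phase_domain_def)
    (cases y, auto simp: entropy_rate_def)

lemma measurable_entropy_rate: "entropy_rate \<in> borel_measurable borel"
proof -
  note [measurable] = measurable_bandB[OF model] measurable_invB[OF model] measurable_dosB[OF model]
    measurable_indicator_mult[OF cont_potential]
  have "entropy_rate \<in> borel_measurable (borel \<Otimes>\<^sub>M (borel \<Otimes>\<^sub>M borel))"
    unfolding entropy_rate_def collisionB_def case_prod_unfold by measurable
  then show ?thesis by (simp add: borel_prod)
qed

text \<open>The bound is uniform over all \<open>F\<close> bounded by \<open>M\<close>, because it
  is applied to the slices of \<open>U\<close>, which vary with x. In it \<open>2 * M\<close> comes
  from the \<mu>' interval of length 2, and \<open>R\<close> sums the rates times the bound
  \<open>K\<close> of \<open>dosB\<close>.\<close>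

lemma collisionB_bounded:
  assumes M: "0 \<le> M"
  shows "\<exists>C. \<forall>F. (\<forall>z. \<bar>F z\<bar> \<le> M) \<longrightarrow> (\<forall>z. \<bar>collisionB D F z\<bar> \<le> C)"
proof -
  obtain K where K: "0 \<le> K" "\<And>e. \<bar>dosB D e\<bar> \<le> K"
    using dosB_bounded[OF model] by blast
  define R where "R = (\<Sum>j\<in>{-1..1::int}. rate D j * K)"
  have "\<bar>collisionB D F z\<bar> \<le> 2 * pi * (2 * M * R) + 4 * pi * M * R" if F: "\<And>z. \<bar>F z\<bar> \<le> M" for F z
  proof -
    obtain p \<mu> where [simp]: "z = (p, \<mu>)" by (cases z) auto
    have I: "\<bar>LINT \<mu>'|lborel. indicator {-1..1} \<mu>' * F (e, \<mu>')\<bar> \<le> 2 * M" for e :: real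
    proof -
      have int: "integrable lborel (\<lambda>\<mu>'::real. indicator {-1..1} \<mu>' * M)" by simp
      have "\<bar>LINT \<mu>'|lborel. indicator {-1..1} \<mu>' * F (e, \<mu>')\<bar> \<le> (LINT \<mu>'|lborel. \<bar>indicator {-1..1} \<mu>' * F (e, \<mu>')\<bar>)"
        by (rule integral_abs_bound)
      also have "\<dots> \<le> (LINT \<mu>'|lborel. indicator {-1..1::real} \<mu>' * M)"
        using F M by (intro integral_mono'[OF int]) (auto simp: indicator_def)
      also have "\<dots> = 2 * M" by simp
      finally show ?thesis .
    qed
    have "\<bar>\<Sum>j\<in>{-1..1::int}. rate D j * (LINT \<mu>'|lborel. indicator {-1..1} \<mu>' * F (invB D (bandB D p + of_int j * phonon_energy D), \<mu>'))
          * dosB D (bandB D p + of_int j * phonon_energy D)\<bar> \<le> (\<Sum>j\<in>{-1..1::int}. rate D j * (2 * M) * K)"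
      by (intro order_trans[OF sum_abs] sum_mono)
        (auto simp: abs_mult rate_nonneg[OF model] intro!: mult_mono mult_nonneg_nonneg I K M)
    then have 1: "\<bar>\<Sum>j\<in>{-1..1::int}. rate D j * (LINT \<mu>'|lborel. indicator {-1..1} \<mu>' * F (invB D (bandB D p + of_int j * phonon_energy D), \<mu>'))
          * dosB D (bandB D p + of_int j * phonon_energy D)\<bar> \<le> 2 * M * R"
      by (simp add: R_def sum_distrib_left mult_ac)
    have 2: "\<bar>\<Sum>j\<in>{-1..1::int}. rate D j * dosB D (bandB D p - of_int j * phonon_energy D)\<bar> \<le> R"
      unfolding R_def
      by (intro order_trans[OF sum_abs] sum_mono)
        (auto simp: abs_mult rate_nonneg[OF model] intro!: mult_mono K)
    have "\<bar>F (p, \<mu>) * (\<Sum>j\<in>{-1..1::int}. rate D j * dosB D (bandB D p - of_int j * phonon_energy D))\<bar> \<le> M * R"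
      unfolding abs_mult using F 2 M by (intro mult_mono) auto
    with 1 show ?thesis
      unfolding collisionB_def \<open>z = (p, \<mu>)\<close> prod.case mult.assoc
      by (intro order_trans[OF abs_triangle_ineq4] add_mono) (auto simp: abs_mult)
  qed
  then show ?thesis by blast
qed

lemma entropy_rate_bounded: obtains C where "\<And>z. \<bar>entropy_rate z\<bar> \<le> C"
proof -
  obtain M where M: "0 \<le> M" "\<And>z. \<bar>U z\<bar> \<le> M" using U_bounded by blast
  obtain C where C: "\<And>F z. (\<And>z. \<bar>F z\<bar> \<le> M) \<Longrightarrow> \<bar>collisionB D F z\<bar> \<le> C"
    using collisionB_bounded[OF M(1)] by blast
  have C0: "0 \<le> C" using C[of "\<lambda>_. 0" undefined] M(1) by auto
  have "bounded (\<phi> ` {0..len D})"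
    by (intro compact_imp_bounded compact_continuous_image cont_potential) simp
  then obtain Q where Q: "\<forall>x\<in>{0..len D}. \<bar>\<phi> x\<bar> \<le> Q" by (auto simp: bounded_iff)
  have q: "0 < q" using model by (auto simp: bp_model_def)
  have "\<bar>entropy_rate (x, p, \<mu>)\<bar> \<le> C * M * exp (band D (pmax D) + q * Q) * (pmax D)\<^sup>2" for x p \<mu>
  proof (cases "(x, p, \<mu>) \<in> phase_domain D")
    case True
    then have x: "x \<in> {0..len D}" and p: "p \<in> {0..pmax D}" and m: "\<mu> \<in> {-1..1}"
      by (auto simp: phase_domain_def)
    have "- Q \<le> \<phi> x" using bspec[OF Q x] by linarith
    then have "q * (- Q) \<le> q * \<phi> x" using q by (intro mult_left_mono) auto
    then have "bandB D p - q * (indicator {0..len D} x * \<phi> x) \<le> band D (pmax D) + q * Q"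
      using bandB_bounds(2)[OF model, of p] x by simp
    moreover have "\<bar>collisionB D (\<lambda>y. U (x, y)) (p, \<mu>)\<bar> \<le> C" by (rule C) (rule M)
    ultimately have "\<bar>collisionB D (\<lambda>y. U (x, y)) (p, \<mu>) * U (x, p, \<mu>) *
       exp (bandB D p - q * (indicator {0..len D} x * \<phi> x)) * p\<^sup>2\<bar> \<le> C * M * exp (band D (pmax D) + q * Q) * (pmax D)\<^sup>2"
      unfolding abs_mult using p C0 M by (intro mult_mono) (auto intro: power_mono)
    then show ?thesis using x p m by (simp add: entropy_rate_def)
  next
    case False
    then show ?thesis using C0 M by (simp add: entropy_rate_outside)
  qed
  then show ?thesis using that by (metis prod_cases3)
qed

lemma integrable_entropy_rate:
  "integrable lborel entropy_rate" "integrable lborel (\<lambda>y. entropy_rate (x, y))"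
proof -
  obtain C where C: "\<And>z. \<bar>entropy_rate z\<bar> \<le> C" using entropy_rate_bounded by blast
  have "compact (phase_domain D)" unfolding phase_domain_def cbox_brick by (rule compact_cbox)
  then show "integrable lborel entropy_rate"
    by (rule integrable_bounded_support[OF measurable_entropy_rate C]) (rule entropy_rate_outside)
  have "(\<lambda>y. entropy_rate (x, y)) \<in> borel_measurable borel"
    by (rule measurable_compose[OF _ measurable_entropy_rate]) simp
  moreover have "compact ({0..pmax D} \<times> {-1..1::real})" unfolding cbox_rect by (rule compact_cbox)
  ultimately show "integrable lborel (\<lambda>y. entropy_rate (x, y))"
    by (rule integrable_bounded_support[OF _ C]) (rule entropy_rate_outside)
qed

lemma entropy_rate_section_nonpos: "(LINT y|lborel. entropy_rate (x, y)) \<le> 0"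
proof (cases "x \<in> {0..len D}")
  case False
  then show ?thesis by (simp add: entropy_rate_def case_prod_unfold)
next
  case True
  obtain M where M: "\<And>z. \<bar>U z\<bar> \<le> M" using U_bounded by blast
  define F where "F = (\<lambda>y. U (x, y))"
  have F: "F \<in> borel_measurable borel" "\<And>z. \<bar>F z\<bar> \<le> M"
    unfolding F_def using M by (auto intro!: measurable_compose[OF _ measurable_U])
  define S where "S = {0..pmax D} \<times> {-1..1::real}"
  \<comment> \<open>On a slice the potential part of e^H is this positive constant. Taking it out
    leaves the test function F e^\<epsilon> of \<open>collision_entropy_nonpos\<close>.\<close>
  define c where "c = exp (- q * \<phi> x)"
  have "(LINT y|lborel. entropy_rate (x, y)) = integral UNIV (\<lambda>y. entropy_rate (x, y))"
    by (rule integral_lborel[symmetric, OF integrable_entropy_rate(2)])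
  also have "\<dots> = integral UNIV (\<lambda>y. if y \<in> S then entropy_rate (x, y) else 0)"
    by (rule integral_cong) (simp add: entropy_rate_outside S_def)
  also have "\<dots> = integral S (\<lambda>y. entropy_rate (x, y))"
    by (rule Henstock_Kurzweil_Integration.integral_restrict_UNIV)
  \<comment> \<open>Back from \<open>collisionB\<close> to \<open>collision\<close>, the operator
    for which dissipativity is stated; the two agree off the resonant momenta.\<close>
  also have "\<dots> = integral S (\<lambda>y. c * (case y of (p, \<mu>) \<Rightarrow> collision D F (p, \<mu>) * (F (p, \<mu>) * exp (bandB D p)) * p\<^sup>2))"
  proof (rule integral_spike)
    show "negligible {y :: real \<times> real. fst y \<in> resonant D}"
      by (rule negligible_coordinate(1)[OF finite_resonant[OF model]])
    fix y assume y: "y \<in> S - {y. fst y \<in> resonant D}"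
    obtain p \<mu> where [simp]: "y = (p, \<mu>)" by (cases y) auto
    have "collision D F (p, \<mu>) = collisionB D F (p, \<mu>)"
      by (rule collision_eq_collisionB[OF model F]) (use y in \<open>auto simp: S_def\<close>)
    then show "c * (case y of (p, \<mu>) \<Rightarrow> collision D F (p, \<mu>) * (F (p, \<mu>) * exp (bandB D p)) * p\<^sup>2) = entropy_rate (x, y)"
      using y True by (simp add: entropy_rate_def S_def F_def c_def exp_diff exp_minus field_simps)
  qed
  also have "\<dots> = c * integral S (\<lambda>(p, \<mu>). collision D F (p, \<mu>) * (F (p, \<mu>) * exp (bandB D p)) * p\<^sup>2)"
    by simp
  also have "\<dots> \<le> 0"
    using collision_entropy_nonpos[OF model F] by (simp add: c_def S_def mult_le_0_iff)
  finally show ?thesis .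
qed

text \<open>The sign on slices is integrated over x. Fubini is applied to Lebesgue integrals, with
  which the gauge integral agrees because \<open>entropy_rate\<close> is Lebesgue
  integrable.\<close>

lemma integral_entropy_rate_nonpos: "integral (phase_domain D) entropy_rate \<le> 0"
proof -
  have "integral (phase_domain D) entropy_rate
      = integral UNIV (\<lambda>z. if z \<in> phase_domain D then entropy_rate z else 0)"
    by (rule Henstock_Kurzweil_Integration.integral_restrict_UNIV[symmetric])
  also have "\<dots> = integral UNIV entropy_rate"
    by (rule integral_cong) (simp add: entropy_rate_outside)
  also have "\<dots> = (LINT z|(lborel \<Otimes>\<^sub>M lborel). entropy_rate z)"
    unfolding lborel_prod by (rule integral_lborel[OF integrable_entropy_rate(1)])
  also have "\<dots> = (LINT x|lborel. LINT y|lborel. entropy_rate (x, y))"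
    using integrable_entropy_rate(1) by (intro lborel_pair.integral_fst'[symmetric]) (simp add: lborel_prod)
  also have "\<dots> \<le> 0"
  proof -
    have "0 \<le> (LINT x|lborel. - (LINT y|lborel. entropy_rate (x, y)))"
      using entropy_rate_section_nonpos by (intro Bochner_Integration.integral_nonneg) simp
    then show ?thesis by simp
  qed
  finally show ?thesis .
qed

lemma collision_terms_nonpos:
  "(\<Sum>(i, k, m)\<in>cells. integral (cell D i k m)
      (\<lambda>(x, p, \<mu>). collision D (\<lambda>(p', \<mu>'). u (x, p', \<mu>')) (p, \<mu>) * u (x, p, \<mu>) * exp (H x p) * p\<^sup>2)) \<le> 0"
proof -
  define g where "g = (\<lambda>(x, p, \<mu>). collision D (\<lambda>(p', \<mu>'). u (x, p', \<mu>')) (p, \<mu>) * u (x, p, \<mu>) * exp (H x p) * p\<^sup>2)"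
  obtain M where M: "\<And>z. \<bar>U z\<bar> \<le> M" using U_bounded by blast
  define N where "N = grid \<union> {z. fst (snd z) \<in> resonant D}"
  have N: "negligible N"
    unfolding N_def by (intro negligible_Un negligible_grid negligible_coordinate finite_resonant[OF model])
  have g: "g z = entropy_rate z" if z: "z \<in> phase_domain D" "z \<notin> N" for z
  proof -
    obtain x p \<mu> where [simp]: "z = (x, p, \<mu>)" by (cases z) auto
    have d: "x \<in> {0..len D}" "p \<in> {0..pmax D}" "\<mu> \<in> {-1..1}" using z by (auto simp: phase_domain_def)
    \<comment> \<open>With x off the nodes, the grid meets the slice at x only in the lines of the p
      and \<mu> nodes, so \<open>u\<close> and \<open>U\<close> agree on the slice as
      \<open>collision_eq_collisionB\<close> requires.\<close>
    have x: "x \<notin> xs D ` {..nx D}" and p: "p \<notin> resonant D" using z by (auto simp: N_def grid_def)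
    have uU: "u (x, p, \<mu>) = U (x, p, \<mu>)" using z U_eq[of z] by (simp add: N_def)
    have "collision D (\<lambda>(p', \<mu>'). u (x, p', \<mu>')) (p, \<mu>) = collisionB D (\<lambda>y. U (x, y)) (p, \<mu>)"
    proof (rule collision_eq_collisionB[OF model _ M d(2) p])
      show "(\<lambda>y. U (x, y)) \<in> borel_measurable borel"
        by (rule measurable_compose[OF _ measurable_U]) simp
      show "(case (p, \<mu>) of (p', \<mu>') \<Rightarrow> u (x, p', \<mu>')) = U (x, p, \<mu>)" by (simp add: uU)
      fix p' \<mu>' assume "p' \<in> {0..pmax D}" "p' \<notin> ps D ` {..np D}" "\<mu>' \<in> {- 1..1}" "\<mu>' \<notin> ms D ` {..nm D}"
      then show "(case (p', \<mu>') of (p', \<mu>') \<Rightarrow> u (x, p', \<mu>')) = U (x, p', \<mu>')"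
        using U_eq[of "(x, p', \<mu>')"] d x by (simp add: phase_domain_def grid_def)
    qed
    then show ?thesis
      using d by (simp add: g_def entropy_rate_def H_def uU bandB_def)
  qed
  have "entropy_rate integrable_on UNIV" by (rule integrable_on_lborel[OF integrable_entropy_rate(1)])
  then have R: "entropy_rate integrable_on cell D i k m" for i k m
    unfolding cell_def cbox_brick by (rule integrable_on_subcbox) simp
  \<comment> \<open>Integrability of the true collision integrand, with its unspecified values, is
    inherited from \<open>entropy_rate\<close>, from which it differs on a null set.\<close>
  have "g integrable_on cell D i k m" if "(i, k, m) \<in> cells" for i k m
    by (rule integrable_spike[OF R N]) (use cell_subset[OF that] in \<open>auto intro!: g\<close>)
  from integral_unique[OF has_integral_phase_domain[OF this]]
  have "(\<Sum>(i, k, m)\<in>cells. integral (cell D i k m) g) = integral (phase_domain D) g" by simp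
  also have "\<dots> = integral (phase_domain D) entropy_rate"
    by (rule integral_spike[OF N]) (simp add: g)
  also have "\<dots> \<le> 0" by (rule integral_entropy_rate_nonpos)
  finally show ?thesis by (simp add: g_def)
qed

lemma total_energy_nonpos:
  assumes eq: "\<And>i k m. (i, k, m) \<in> cells \<Longrightarrow> dg_equation D E H u u' u i k m"
  shows "(\<Sum>(i, k, m)\<in>cells. integral (cell D i k m)
      (\<lambda>(x, p, \<mu>). u (x, p, \<mu>) * u' (x, p, \<mu>) * exp (H x p) * p\<^sup>2)) \<le> 0"
proof -
  define I where "I i k m = integral (cell D i k m) (\<lambda>(x, p, \<mu>). u (x, p, \<mu>) * u' (x, p, \<mu>) * exp (H x p) * p\<^sup>2)" for i k m
  define Q where "Q i k m = integral (cell D i k m)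
      (\<lambda>(x, p, \<mu>). collision D (\<lambda>(p', \<mu>'). u (x, p', \<mu>')) (p, \<mu>) * u (x, p, \<mu>) * exp (H x p) * p\<^sup>2)" for i k m
  define X where "X i k m = integral (CP k \<times> CM m) (jump_x i k m)" for i k m
  define Y where "Y i k m = integral (CX i \<times> CM m) (jump_p i k m)" for i k m
  define Z where "Z i k m = integral (CX i \<times> CP k) (jump_m i k m)" for i k m
  have "(\<Sum>(i, k, m)\<in>cells. I i k m) = (\<Sum>(i, k, m)\<in>cells. Q i k m - X i k m - Y i k m - Z i k m)"
  proof (rule sum.cong[OF refl])
    fix c assume c: "c \<in> cells"
    obtain i k m where [simp]: "c = (i, k, m)" by (cases c) auto
    have "I i k m + X i k m + Y i k m + Z i k m = Q i k m"
      unfolding I_def X_def Y_def Z_def Q_def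
      by (rule cell_energy_balance) (use c eq in \<open>auto simp: cells_def\<close>)
    then show "(case c of (i, k, m) \<Rightarrow> I i k m) = (case c of (i, k, m) \<Rightarrow> Q i k m - X i k m - Y i k m - Z i k m)"
      by simp
  qed
  also have "\<dots> = (\<Sum>(i, k, m)\<in>cells. Q i k m) - (\<Sum>i<nx D. \<Sum>k<np D. \<Sum>m<nm D. X i k m)
      - (\<Sum>i<nx D. \<Sum>k<np D. \<Sum>m<nm D. Y i k m) - (\<Sum>i<nx D. \<Sum>k<np D. \<Sum>m<nm D. Z i k m)"
    by (simp add: sum_cells sum_subtractf)
  finally have *: "(\<Sum>(i, k, m)\<in>cells. I i k m) = \<dots>" .
  \<comment> \<open>Each family of jumps has a sign only when summed along its own direction, so
    that index is moved innermost.\<close>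
  have "(\<Sum>i<nx D. \<Sum>k<np D. \<Sum>m<nm D. X i k m) = (\<Sum>k<np D. \<Sum>m<nm D. \<Sum>i<nx D. X i k m)"
    by (subst sum.swap) (intro sum.cong refl sum.swap)
  also have "0 \<le> \<dots>"
    unfolding X_def by (intro sum_nonneg jump_x_sum_nonneg) auto
  finally have X: "0 \<le> (\<Sum>i<nx D. \<Sum>k<np D. \<Sum>m<nm D. X i k m)" .
  have "(\<Sum>i<nx D. \<Sum>k<np D. \<Sum>m<nm D. Y i k m) = (\<Sum>i<nx D. \<Sum>m<nm D. \<Sum>k<np D. Y i k m)"
    by (intro sum.cong refl sum.swap)
  also have "0 \<le> \<dots>"
    unfolding Y_def by (intro sum_nonneg jump_p_sum_nonneg) auto
  finally have Y: "0 \<le> (\<Sum>i<nx D. \<Sum>k<np D. \<Sum>m<nm D. Y i k m)" .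
  have Z: "0 \<le> (\<Sum>i<nx D. \<Sum>k<np D. \<Sum>m<nm D. Z i k m)"
    unfolding Z_def by (intro sum_nonneg jump_m_sum_nonneg) auto
  have "(\<Sum>(i, k, m)\<in>cells. Q i k m) \<le> 0"
    unfolding Q_def by (rule collision_terms_nonpos)
  with * X Y Z show ?thesis by (simp add: I_def)
qed

end

subsection \<open>The stability estimate\<close>

text \<open>Ensures that the derivative within the half line is unique, including the one-sided
  derivative at t = 0, so that \<open>time_deriv\<close> equals any derivative that is
  exhibited.\<close>

lemma at_within_Ici_neq_bot:
  assumes "0 \<le> t"
  shows "at t within {0..} \<noteq> (bot :: real filter)"
proof -
  have "t islimpt {0::real..}"
  proof (rule connected_imp_perfect)
    show "{0..} \<noteq> {x}" for x :: real
    proof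
      assume "{0..} = {x}"
      then have "0 \<in> {x}" "1 \<in> {x}" by (auto simp flip: \<open>{0..} = {x}\<close>)
      then show False by simp
    qed
  qed (use assms in auto)
  then show ?thesis by (simp add: trivial_limit_within)
qed

lemma time_deriv_eq:
  assumes "0 \<le> t" "((\<lambda>s. g s) has_real_derivative y) (at t within {0..})"
    and "\<And>s. 0 \<le> s \<Longrightarrow> f s z = g s"
  shows "time_deriv f t z = y"
proof -
  have "((\<lambda>s. f s z) has_vector_derivative y) (at t within {0..})"
    by (rule has_vector_derivative_transform[where f = g])
      (use assms in \<open>auto simp: has_real_derivative_iff_has_vector_derivative\<close>)
  then show ?thesis
    unfolding time_deriv_def by (rule vector_derivative_within[OF at_within_Ici_neq_bot[OF assms(1)]])
qed

theorem theorem4p1: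
  fixes D :: bp_data and d :: nat
    and V :: "real \<Rightarrow> real \<Rightarrow> real"
    and f :: "real \<Rightarrow> real \<times> real \<times> real \<Rightarrow> real"
    and t :: real
  assumes "bp_model D"
    and "dg_solution D d V f"
    and "0 \<le> t"
  shows "0 \<ge> integral (phase_domain D) (\<lambda>(x, p, \<mu>).
            f t (x, p, \<mu>) * time_deriv f t (x, p, \<mu>) * exp (hamiltonian D V x p t) * p\<^sup>2)
    \<and> integral (phase_domain D) (\<lambda>(x, p, \<mu>).
            f t (x, p, \<mu>) * time_deriv f t (x, p, \<mu>) * exp (hamiltonian D V x p t) * p\<^sup>2)
        = 1 / 2 * integral (phase_domain D) (\<lambda>(x, p, \<mu>).
            time_deriv (\<lambda>s z. (f s z)\<^sup>2) t (x, p, \<mu>) * exp (hamiltonian D V x p t) * p\<^sup>2)"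
proof -
  \<comment> \<open>The index bounds stand inside the existential so that the choice yields one
    family \<open>c\<close> over all indices.\<close>
  have "\<forall>i k m. \<exists>c. i < nx D \<longrightarrow> k < np D \<longrightarrow> m < nm D \<longrightarrow>
      (\<forall>\<alpha>. (\<lambda>t. c t \<alpha>) differentiable_on {0..}) \<and>
      (\<forall>t\<ge>0. \<forall>z\<in>interior (cell D i k m). f t z = poly3 d (c t) z)"
    using assms(2) unfolding dg_solution_def dg_curve_def by blast
  then obtain c where c: "\<And>i k m \<alpha>. \<lbrakk>i < nx D; k < np D; m < nm D\<rbrakk> \<Longrightarrow> (\<lambda>t. c i k m t \<alpha>) differentiable_on {0..}"
    and fc: "\<And>i k m t z. \<lbrakk>i < nx D; k < np D; m < nm D; 0 \<le> t; z \<in> interior (cell D i k m)\<rbrakk>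
      \<Longrightarrow> f t z = poly3 d (c i k m t) z"
    by metis
  define c' where "c' i k m \<alpha> = vector_derivative (\<lambda>s. c i k m s \<alpha>) (at t within {0..})" for i k m \<alpha>
  have c': "((\<lambda>s. c i k m s \<alpha>) has_real_derivative c' i k m \<alpha>) (at t within {0..})"
    if "i < nx D" "k < np D" "m < nm D" for i k m \<alpha>
  proof -
    have "(\<lambda>s. c i k m s \<alpha>) differentiable (at t within {0..})"
      using c[OF that] \<open>0 \<le> t\<close> by (simp add: differentiable_on_def)
    then show ?thesis
      by (simp add: c'_def vector_derivative_works has_real_derivative_iff_has_vector_derivative)
  qed
  have V: "(\<lambda>x. V x t) differentiable_on {0..len D}" "continuous_on {0..len D} (\<lambda>x. efield D V x t)"
    "V 0 t = V (len D) t"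
    using assms(2,3) unfolding dg_solution_def poisson_def by auto
  interpret bp_snapshot D d "\<lambda>x. V x t" "\<lambda>x. efield D V x t" "f t" "\<lambda>i k m. c i k m t"
  proof
    show "((\<lambda>x. V x t) has_real_derivative - efield D V x t) (at x within {0..len D})"
      if "x \<in> {0..len D}" for x
    proof -
      have "(\<lambda>x. V x t) differentiable (at x within {0..len D})"
        using V(1) that by (simp add: differentiable_on_def)
      then show ?thesis
        by (simp add: efield_def vector_derivative_works has_real_derivative_iff_has_vector_derivative)
    qed
  qed (use assms V fc in auto)
  have H: "H x p = hamiltonian D V x p t" for x p
    by (simp add: H_def hamiltonian_def)
  \<comment> \<open>Both formulas are confined to cell interiors, where the values of f_h in time
    come from differentiable coefficients; at a mesh face nothing is known about the curve.\<close>
  have ft: "time_deriv f t z = poly3 d (c' i k m) z"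
    and ft2: "time_deriv (\<lambda>s z. (f s z)\<^sup>2) t z = 2 * (f t z * time_deriv f t z)"
    if "(i, k, m) \<in> cells" "z \<in> interior (cell D i k m)" for i k m z
  proof -
    have ikm: "i < nx D" "k < np D" "m < nm D" using that by (auto simp: cells_def)
    have *: "((\<lambda>s. poly3 d (c i k m s) z) has_real_derivative poly3 d (c' i k m) z) (at t within {0..})"
      by (rule poly3_has_real_derivative_coeffs[OF c'[OF ikm]])
    show 1: "time_deriv f t z = poly3 d (c' i k m) z"
      by (rule time_deriv_eq[OF \<open>0 \<le> t\<close> *]) (rule fc[OF ikm _ that(2)])
    have "((\<lambda>s. (poly3 d (c i k m s) z)\<^sup>2) has_real_derivative
        2 * (f t z * time_deriv f t z)) (at t within {0..})"
      unfolding 1 fc[OF ikm \<open>0 \<le> t\<close> that(2)] by (auto intro!: derivative_eq_intros *)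
    then show "time_deriv (\<lambda>s z. (f s z)\<^sup>2) t z = 2 * (f t z * time_deriv f t z)"
      by (rule time_deriv_eq[OF \<open>0 \<le> t\<close>]) (simp add: fc[OF ikm _ that(2)])
  qed
  define g where "g = (\<lambda>(x, p, \<mu>). f t (x, p, \<mu>) * time_deriv f t (x, p, \<mu>) * exp (H x p) * p\<^sup>2)"
  \<comment> \<open>Splitting the integral over the phase domain into cells requires integrability;
    on each cell \<open>g\<close> agrees off the grid with a continuous function.\<close>
  have int: "g integrable_on cell D i k m" if ikm: "(i, k, m) \<in> cells" for i k m
  proof -
    have lt: "i < nx D" "k < np D" "m < nm D" using that by (auto simp: cells_def)
    define h where "h = (\<lambda>(x, p, \<mu>). P i k m (x, p, \<mu>) * poly3 d (c' i k m) (x, p, \<mu>) * exp (H x p) * p\<^sup>2)"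
    have "continuous_on (cell D i k m) h"
      unfolding h_def cell_def H_def case_prod_unfold
      by (intro basic_continuous_intros continuous_on_poly3 continuous_on_cell lt)
    then have h: "h integrable_on cell D i k m"
      unfolding cell_def by (rule integrable_brick)
    show ?thesis
    proof (rule integrable_spike[OF h negligible_grid])
      fix z assume z: "z \<in> cell D i k m - grid"
      obtain x p \<mu> where [simp]: "z = (x, p, \<mu>)" by (cases z) auto
      have zi: "(x, p, \<mu>) \<in> interior (cell D i k m)" using cell_minus_grid[OF lt, of z] z by simp
      show "g z = h z"
        using ft[OF ikm zi] fc[OF lt \<open>0 \<le> t\<close> zi] by (simp add: g_def h_def)
    qed
  qed
  have "integral (phase_domain D) g = (\<Sum>(i, k, m)\<in>cells. integral (cell D i k m) g)"
    by (rule integral_unique[OF has_integral_phase_domain[OF int]])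
  also have "\<dots> \<le> 0"
    unfolding g_def
  proof (rule total_energy_nonpos)
    fix i k m assume "(i, k, m) \<in> cells"
    then have lt: "i < nx D" "k < np D" "m < nm D" by (auto simp: cells_def)
    have "f t \<in> dg_space D d" using fc[OF _ _ _ \<open>0 \<le> t\<close>] unfolding dg_space_def by blast
    then have "dg_equation D (\<lambda>x. efield D V x t) (\<lambda>x p. hamiltonian D V x p t) (f t) (time_deriv f t) (f t) i k m"
      using assms(2,3) lt unfolding dg_solution_def by blast
    then show "dg_equation D (\<lambda>x. efield D V x t) H (f t) (time_deriv f t) (f t) i k m"
      unfolding H[symmetric] .
  qed
  finally have le: "integral (phase_domain D) g \<le> 0" .
  have "integral (phase_domain D) (\<lambda>(x, p, \<mu>).
      time_deriv (\<lambda>s z. (f s z)\<^sup>2) t (x, p, \<mu>) * exp (H x p) * p\<^sup>2) = integral (phase_domain D) (\<lambda>z. 2 * g z)"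
  proof (rule integral_spike[OF negligible_grid])
    fix z assume "z \<in> phase_domain D - grid"
    then obtain i k m where "(i, k, m) \<in> cells" "z \<in> interior (cell D i k m)"
      using phase_domain_minus_grid by blast
    from ft2[OF this] show "2 * g z = (case z of (x, p, \<mu>) \<Rightarrow>
        time_deriv (\<lambda>s z. (f s z)\<^sup>2) t (x, p, \<mu>) * exp (H x p) * p\<^sup>2)"
      by (cases z) (simp add: g_def)
  qed
  then have "integral (phase_domain D) g = 1 / 2 * integral (phase_domain D) (\<lambda>(x, p, \<mu>).
      time_deriv (\<lambda>s z. (f s z)\<^sup>2) t (x, p, \<mu>) * exp (H x p) * p\<^sup>2)"
    by simp
  with le show ?thesis unfolding g_def H by simp
qed

end
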